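(* Let $n\ge 3$ and consider the affine Weyl group $W_{\mathrm{aff}}$ of type $A_{n-1}^{(1)}$, with $c=\alpha_0+\alpha_1+\dots+\alpha_{n-1}$ and $\Pi$ the finite root system of type $A_{n-1}$. Then: (1) $\Gamma_c(id)=\{t_\gamma:\gamma\in\Pi\}$; (2) $|\Gamma_c(id)|=n(n-1)$; (3) $\ell(w)=2(n-1)$ for all $w\in\Gamma_c(id)$.
   Context: Roots. Let $n\ge 3$. Let $\alpha_0,\dots,\alpha_{n-1}$ (indices mod $n$) be the affine simple roots of type $A_{n-1}^{(1)}$, $Q_{\mathrm{aff}}=\bigoplus_{i=0}^{n-1}\mathbb Z\alpha_i$, with symmetric form $\langle\alpha_i,\alpha_i\rangle=2$, $\langle\alpha_i,\alpha_{i\pm1}\rangle=-1$, all other $\langle\alpha_i,\alpha_j\rangle=0$. Put $c=\sum_{i=0}^{n-1}\alpha_i$ (identified with the imaginary root $\delta$). Let $\Pi=\Pi^+\sqcup\Pi^-$ be the finite root system of type $A_{n-1}$ with simple roots $\alpha_1,\dots,\alpha_{n-1}$. The affine real roots are $\alpha+mc$ with $\alpha\in\Pi$, $m\in\mathbb Z$; such a root is positive if $m>0$, or $m=0$ and $\alpha\in\Pi^+$. The set of positive real roots is $\Pi_{\mathrm{aff}}^{\mathrm{re},+}$. Weyl group. For a real root $\alpha$, $s_\alpha(\mu)=\mu-\langle\mu,\alpha\rangle\alpha$. $W_{\mathrm{aff}}$ is the group generated by $s_i=s_{\alpha_i}$, $0\le i\le n-1$ (a Coxeter group with these generators), with length $\ell$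 and Bruhat order $\le$. One has $W_{\mathrm{aff}}=W\ltimes Q$, where $W=\langle s_1,\dots,s_{n-1}\rangle$ and $Q=\bigoplus_{i=1}^{n-1}\mathbb Z\alpha_i$ (root and coroot lattices identified); $t_\mu$ denotes the image of $\mu\in Q$, with $s_{\alpha+mc}=s_\alpha t_{m\alpha}$ for $\alpha\in\Pi$, $m\in\mathbb Z$ (so $t_\mu(\nu)=\nu-\langle\mu,\nu\rangle c$). Curve neighborhoods. The moment graph has vertex set $W_{\mathrm{aff}}$ and an edge $u\stackrel{\alpha}{\longrightarrow}us_\alpha$ of degree $\alpha$ for each $u\in W_{\mathrm{aff}}$, $\alpha\in\Pi_{\mathrm{aff}}^{\mathrm{re},+}$. The degree of a chain (a succession of adjacent edges, possibly empty) is the sum of the degrees of its edges. A degree is a tuple $\mathbf d=(d_0,\dots,d_{n-1})\in\mathbb Z_{\ge0}^n$, identified with $\sum d_i\alpha_i$; degrees are ordered componentwise. For $u\in W_{\mathrm{aff}}$, $\Gamma_{\mathbf d}(u)$ is the set of Bruhat-maximal elements of the set of all $v\in W_{\mathrm{aff}}$ that can be joined to some $u'\le u$ by a chain of degree $\le\mathbf d$. *)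

theory Defs
  imports
    "HOL-Algebra.Bij"
    "HOL-Algebra.Generated_Groups"
    "HOL-Library.Function_Algebras"
begin

section \<open>Affine root lattice of type \<open>A\<^sub>n\<^sub>-\<^sub>1\<^sup>(\<^sup>1\<^sup>)\<close>\<close>

text \<open>An element \<open>\<Sum>i<n. m i \<alpha>\<^sub>i\<close> of the affine root lattice is its coefficient function
  \<open>m :: nat \<Rightarrow> int\<close>, required to vanish outside \<open>{..<n}\<close>. Sums, \<open>0\<close> and \<open>\<le>\<close> are pointwise,
  so \<open>\<le>\<close> on degrees is the componentwise order.\<close>

definition Qaff :: "nat \<Rightarrow> (nat \<Rightarrow> int) set" where
  "Qaff n = {\<mu>. \<forall>i\<ge>n. \<mu> i = 0}"

definition zscale :: "int \<Rightarrow> (nat \<Rightarrow> int) \<Rightarrow> (nat \<Rightarrow> int)" where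
  "zscale m \<mu> = (\<lambda>j. m * \<mu> j)"

definition simple_root :: "nat \<Rightarrow> (nat \<Rightarrow> int)" where
  "simple_root i = (\<lambda>j. if j = i then 1 else 0)"

definition cdelta :: "nat \<Rightarrow> (nat \<Rightarrow> int)" where
  "cdelta n = (\<Sum>i<n. simple_root i)"

text \<open>The Cartan matrix is that of an \<open>n\<close>-cycle; this is type \<open>A\<^sub>n\<^sub>-\<^sub>1\<^sup>(\<^sup>1\<^sup>)\<close> only for \<open>n \<ge> 3\<close>.\<close>

definition cartan :: "nat \<Rightarrow> nat \<Rightarrow> nat \<Rightarrow> int" where
  "cartan n i j =
    (if i = j then 2 else if j = (i + 1) mod n \<or> i = (j + 1) mod n then - 1 else 0)"

definition form :: "nat \<Rightarrow> (nat \<Rightarrow> int) \<Rightarrow> (nat \<Rightarrow> int) \<Rightarrow> int" where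
  "form n \<mu> \<nu> = (\<Sum>i<n. \<Sum>j<n. \<mu> i * \<nu> j * cartan n i j)"


section \<open>Affine Weyl group\<close>

text \<open>The Weyl group is realised inside the group of permutations of \<^const>\<open>Qaff\<close>, on which it acts
  faithfully: a translation by \<open>\<mu> \<noteq> 0\<close> moves \<open>\<nu>\<close> by \<open>- \<langle>\<mu>, \<nu>\<rangle> c\<close>, and the form is nondegenerate
  on the finite root lattice.\<close>

abbreviation GQ :: "nat \<Rightarrow> ((nat \<Rightarrow> int) \<Rightarrow> (nat \<Rightarrow> int)) monoid" where
  "GQ n \<equiv> BijGroup (Qaff n)"

definition reflection :: "nat \<Rightarrow> (nat \<Rightarrow> int) \<Rightarrow> ((nat \<Rightarrow> int) \<Rightarrow> (nat \<Rightarrow> int))" where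
  "reflection n \<alpha> = (\<lambda>\<mu>\<in>Qaff n. \<mu> - zscale (form n \<mu> \<alpha>) \<alpha>)"

definition simple_refl :: "nat \<Rightarrow> nat \<Rightarrow> ((nat \<Rightarrow> int) \<Rightarrow> (nat \<Rightarrow> int))" where
  "simple_refl n i = reflection n (simple_root i)"

definition Waff :: "nat \<Rightarrow> ((nat \<Rightarrow> int) \<Rightarrow> (nat \<Rightarrow> int)) set" where
  "Waff n = generate (GQ n) (simple_refl n ` {0..<n})"

definition Wfin :: "nat \<Rightarrow> ((nat \<Rightarrow> int) \<Rightarrow> (nat \<Rightarrow> int)) set" where
  "Wfin n = generate (GQ n) (simple_refl n ` {1..<n})"

definition transl :: "nat \<Rightarrow> (nat \<Rightarrow> int) \<Rightarrow> ((nat \<Rightarrow> int) \<Rightarrow> (nat \<Rightarrow> int))" where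
  "transl n \<mu> = (\<lambda>\<nu>\<in>Qaff n. \<nu> - zscale (form n \<mu> \<nu>) (cdelta n))"


section \<open>Roots\<close>

definition fin_roots :: "nat \<Rightarrow> (nat \<Rightarrow> int) set" where
  "fin_roots n = {w (simple_root i) | w i. w \<in> Wfin n \<and> i \<in> {1..<n}}"

definition fin_pos_roots :: "nat \<Rightarrow> (nat \<Rightarrow> int) set" where
  "fin_pos_roots n = {\<alpha> \<in> fin_roots n. 0 \<le> \<alpha>}"

definition pos_real_roots :: "nat \<Rightarrow> (nat \<Rightarrow> int) set" where
  "pos_real_roots n =
    {\<alpha> + zscale m (cdelta n) | \<alpha> m.
      \<alpha> \<in> fin_roots n \<and> (m > 0 \<or> m = 0 \<and> \<alpha> \<in> fin_pos_roots n)}"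


section \<open>Length and Bruhat order\<close>

definition word_prod :: "nat \<Rightarrow> nat list \<Rightarrow> ((nat \<Rightarrow> int) \<Rightarrow> (nat \<Rightarrow> int))" where
  "word_prod n is = foldr (\<lambda>i w. simple_refl n i \<otimes>\<^bsub>GQ n\<^esub> w) is \<one>\<^bsub>GQ n\<^esub>"

definition wlength :: "nat \<Rightarrow> ((nat \<Rightarrow> int) \<Rightarrow> (nat \<Rightarrow> int)) \<Rightarrow> nat" where
  "wlength n w = (LEAST k. \<exists>is. length is = k \<and> set is \<subseteq> {0..<n} \<and> w = word_prod n is)"

text \<open>The reflections of the Coxeter group (conjugates of simple reflections) are the \<open>s\<^sub>\<alpha>\<close> for
  positive real roots \<open>\<alpha>\<close>.\<close>

definition bruhat_step ::
  "nat \<Rightarrow> ((nat \<Rightarrow> int) \<Rightarrow> (nat \<Rightarrow> int)) \<Rightarrow> ((nat \<Rightarrow> int) \<Rightarrow> (nat \<Rightarrow> int)) \<Rightarrow> bool" where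
  "bruhat_step n u v \<longleftrightarrow>
    (\<exists>\<alpha>\<in>pos_real_roots n. v = u \<otimes>\<^bsub>GQ n\<^esub> reflection n \<alpha>) \<and> wlength n u < wlength n v"

definition bruhat_le ::
  "nat \<Rightarrow> ((nat \<Rightarrow> int) \<Rightarrow> (nat \<Rightarrow> int)) \<Rightarrow> ((nat \<Rightarrow> int) \<Rightarrow> (nat \<Rightarrow> int)) \<Rightarrow> bool" where
  "bruhat_le n u v \<longleftrightarrow> u \<in> Waff n \<and> v \<in> Waff n \<and> (bruhat_step n)\<^sup>*\<^sup>* u v"


section \<open>Curve neighborhoods\<close>

text \<open>\<open>mg_chain n u v d\<close>: a chain of degree \<open>d\<close> in the moment graph joins \<open>u\<close> to \<open>v\<close>. Traversing an
  edge \<open>u \<midarrow>\<alpha>\<rightarrow> u s\<^sub>\<alpha>\<close> backwards is the edge of the same degree starting at \<open>u s\<^sub>\<alpha>\<close>, so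
  directed steps suffice.\<close>

inductive mg_chain ::
  "nat \<Rightarrow> ((nat \<Rightarrow> int) \<Rightarrow> (nat \<Rightarrow> int)) \<Rightarrow> ((nat \<Rightarrow> int) \<Rightarrow> (nat \<Rightarrow> int)) \<Rightarrow>
    (nat \<Rightarrow> int) \<Rightarrow> bool" for n where
  mg_chain_refl: "u \<in> Waff n \<Longrightarrow> mg_chain n u u 0"
| mg_chain_step: "mg_chain n u v d \<Longrightarrow> \<alpha> \<in> pos_real_roots n \<Longrightarrow>
    mg_chain n u (v \<otimes>\<^bsub>GQ n\<^esub> reflection n \<alpha>) (d + \<alpha>)"

definition reachable ::
  "nat \<Rightarrow> (nat \<Rightarrow> int) \<Rightarrow> ((nat \<Rightarrow> int) \<Rightarrow> (nat \<Rightarrow> int)) \<Rightarrow> ((nat \<Rightarrow> int) \<Rightarrow> (nat \<Rightarrow> int)) set" where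
  "reachable n d u = {v \<in> Waff n. \<exists>u' e. bruhat_le n u' u \<and> mg_chain n u' v e \<and> e \<le> d}"

definition curve_nbhd ::
  "nat \<Rightarrow> (nat \<Rightarrow> int) \<Rightarrow> ((nat \<Rightarrow> int) \<Rightarrow> (nat \<Rightarrow> int)) \<Rightarrow> ((nat \<Rightarrow> int) \<Rightarrow> (nat \<Rightarrow> int)) set" where
  "curve_nbhd n d u =
    {v \<in> reachable n d u. \<forall>v'\<in>reachable n d u. bruhat_le n v v' \<longrightarrow> v' = v}"

end

theory Submission
  imports Defs
begin

text \<open>A chain of degree at most \<open>c\<close> leaving the identity ends in a product
  \<open>s\<^bsub>\<beta>1\<^esub> \<dots> s\<^bsub>\<beta>k\<^esub>\<close> of reflections in positive real roots with pairwise disjoint supports.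
  By strong exchange, \<open>u < u s\<^sub>\<beta>\<close> as soon as \<open>u \<beta> > 0\<close>. This allows to climb in the Bruhat order by
  appending a simple reflection whose root is missing from \<open>\<beta>1 + \<dots> + \<beta>k\<close>, and, once the sum is \<open>c\<close>,
  by merging two adjacent factors \<open>s\<^sub>p s\<^sub>q\<close> with \<open>\<langle>p, q\<rangle> = - 1\<close> into \<open>s\<^bsub>p+q\<^esub>\<close>. The process stops
  at \<open>s\<^sub>\<beta> s\<^bsub>c-\<beta>\<^esub> = t\<^bsub>-\<beta>\<^esub>\<close>. All translations by roots have the same length \<open>2 (n - 1)\<close>, found from
  palindromic words for \<open>s\<^sub>\<beta>\<close> and \<open>s\<^bsub>c-\<beta>\<^esub>\<close> and an inversion count, so they are incomparable.\<close>

text \<open>Roots are handled as intervals of integers, up to a common shift of both endpoints by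
  multiples of \<open>n\<close>. The form becomes a sum of four Kronecker deltas modulo
  \<open>n\<close>, reflections become transpositions of residues, and signs become comparisons of
  endpoints. The climb gets its force from \<open>c\<close> lying in the radical of the form. Once
  the factors sum to \<open>c\<close>, the last factor q pairs to -2 with the sum of the others, so
  some earlier factor must meet it. That factor need not stand next to q: choosing the last p with
  nonzero pairing lets s_q commute past everything in between, and s_p is then reached by
  conjugation. Disjoint supports make the pairing nonpositive, so it is -1 or -2; the value -2
  forces p + q to be a multiple of \<open>c\<close>, which leaves room for no third factor. Images
  of roots are never computed in full to find their sign: every root is positive or negative, so one
  positive coefficient decides.\<close>

lemma int_fun_eq_if_increments_eq:
  fixes f g :: "int \<Rightarrow> int"
  assumes "f x = g x" and step: "\<And>y. f (y + 1) - f y = g (y + 1) - g y"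
  shows "f y = g y"
proof (induction y rule: int_induct[where k = x])
  case base
  show ?case by fact
next
  case (step1 i)
  then show ?case using step[of i] by simp
next
  case (step2 i)
  then show ?case using step[of "i - 1"] by simp
qed

section \<open>Bilinearity of the form\<close>

lemma sum_fun_apply: "(\<Sum>i\<in>A. f i) x = (\<Sum>i\<in>A. f i x)" for f :: "'a \<Rightarrow> 'b \<Rightarrow> int"
  by (induction A rule: infinite_finite_induct) auto

lemma cdelta_apply: "cdelta n j = (if j < n then 1 else 0)"
  by (auto simp: cdelta_def sum_fun_apply simple_root_def)

lemma form_add_left: "form n (\<mu> + \<mu>') \<nu> = form n \<mu> \<nu> + form n \<mu>' \<nu>"
  by (simp add: form_def algebra_simps sum.distrib)

lemma form_zscale_left: "form n (zscale k \<mu>) \<nu> = k * form n \<mu> \<nu>"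
  by (simp add: form_def zscale_def sum_distrib_left mult.assoc)

lemma cartan_commute: "cartan n i j = cartan n j i"
  by (auto simp: cartan_def)

lemma form_commute: "form n \<mu> \<nu> = form n \<nu> \<mu>"
  unfolding form_def
  by (subst sum.swap) (simp add: cartan_commute mult.commute mult.left_commute)

lemma form_add_right: "form n \<mu> (\<nu> + \<nu>') = form n \<mu> \<nu> + form n \<mu> \<nu>'"
  by (metis form_add_left form_commute)

lemma form_zscale_right: "form n \<mu> (zscale k \<nu>) = k * form n \<mu> \<nu>"
  by (metis form_zscale_left form_commute)

lemma form_diff_left: "form n (\<mu> - \<mu>') \<nu> = form n \<mu> \<nu> - form n \<mu>' \<nu>"
  using form_add_left[of n "\<mu> - \<mu>'" \<mu>' \<nu>] by simp

lemma form_diff_right: "form n \<mu> (\<nu> - \<nu>') = form n \<mu> \<nu> - form n \<mu> \<nu>'"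
  by (metis form_diff_left form_commute)

lemma form_minus_left: "form n (- \<mu>) \<nu> = - form n \<mu> \<nu>"
  using form_diff_left[of n 0 \<mu> \<nu>] by (simp add: form_def)

lemma form_minus_right: "form n \<mu> (- \<nu>) = - form n \<mu> \<nu>"
  by (metis form_minus_left form_commute)

lemma form_zero_left [simp]: "form n 0 \<nu> = 0"
  by (simp add: form_def)

lemma form_zero_right [simp]: "form n \<mu> 0 = 0"
  by (simp add: form_def)

lemmas form_linear = form_add_left form_add_right form_diff_left form_diff_right
  form_minus_left form_minus_right form_zscale_left form_zscale_right

lemma form_simple_root:
  assumes "i < n" "j < n"
  shows "form n (simple_root i) (simple_root j) = cartan n i j"
proof -
  have "form n (simple_root i) (simple_root j)
      = (\<Sum>k<n. if k = i then (\<Sum>l<n. if l = j then cartan n i j else 0) else 0)"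
    unfolding form_def simple_root_def by (intro sum.cong refl) (use assms in \<open>auto simp: if_distrib[of "\<lambda>x. x * _"] cong: if_cong\<close>)
  then show ?thesis using assms by simp
qed

text \<open>With disjoint supports only off-diagonal Cartan entries contribute, and these are 0 or
  -1.\<close>

lemma form_disjoint_nonpos:
  assumes "0 \<le> \<mu>" "0 \<le> \<nu>" "\<And>j. \<mu> j = 0 \<or> \<nu> j = 0"
  shows "form n \<mu> \<nu> \<le> 0"
  unfolding form_def
proof (intro sum_nonpos)
  fix i j
  show "\<mu> i * \<nu> j * cartan n i j \<le> 0"
  proof (cases "i = j")
    case True
    then show ?thesis using assms(3)[of i] by auto
  next
    case False
    then have "cartan n i j \<le> 0" by (simp add: cartan_def)
    moreover have "0 \<le> \<mu> i * \<nu> j" using assms(1,2) by (simp add: le_fun_def)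
    ultimately show ?thesis by (simp add: mult_nonneg_nonpos)
  qed
qed

section \<open>Root lattice and height\<close>

lemma Qaff_add: "\<mu> \<in> Qaff n \<Longrightarrow> \<nu> \<in> Qaff n \<Longrightarrow> \<mu> + \<nu> \<in> Qaff n"
  by (simp add: Qaff_def)

lemma Qaff_diff: "\<mu> \<in> Qaff n \<Longrightarrow> \<nu> \<in> Qaff n \<Longrightarrow> \<mu> - \<nu> \<in> Qaff n"
  by (simp add: Qaff_def)

lemma Qaff_minus: "\<mu> \<in> Qaff n \<Longrightarrow> - \<mu> \<in> Qaff n"
  by (simp add: Qaff_def)

lemma Qaff_zscale: "\<mu> \<in> Qaff n \<Longrightarrow> zscale k \<mu> \<in> Qaff n"
  by (simp add: Qaff_def zscale_def)

lemma cdelta_in_Qaff: "cdelta n \<in> Qaff n"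
  by (simp add: Qaff_def cdelta_apply)

lemma simple_root_in_Qaff: "i < n \<Longrightarrow> simple_root i \<in> Qaff n"
  by (auto simp: Qaff_def simple_root_def)

lemmas Qaff_closed = Qaff_add Qaff_diff Qaff_minus Qaff_zscale cdelta_in_Qaff

definition height :: "nat \<Rightarrow> (nat \<Rightarrow> int) \<Rightarrow> int" where
  "height n \<mu> = (\<Sum>j<n. \<mu> j)"

lemma height_add: "height n (\<mu> + \<nu>) = height n \<mu> + height n \<nu>"
  by (simp add: height_def sum.distrib)

lemma height_diff: "height n (\<mu> - \<nu>) = height n \<mu> - height n \<nu>"
  by (simp add: height_def sum_subtractf)

lemma height_zscale: "height n (zscale k \<mu>) = k * height n \<mu>"
  by (simp add: height_def zscale_def sum_distrib_left)

lemma height_simple_root: "i < n \<Longrightarrow> height n (simple_root i) = 1"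
  by (simp add: height_def simple_root_def)

lemma height_cdelta: "height n (cdelta n) = int n"
  by (simp add: height_def cdelta_apply)

lemma height_mono: "\<mu> \<le> \<nu> \<Longrightarrow> height n \<mu> \<le> height n \<nu>"
  by (simp add: height_def le_fun_def sum_mono)

section \<open>Interval roots\<close>

locale affine_type_A =
  fixes n :: nat
  assumes n_ge_3: "3 \<le> n"
begin

text \<open>\<open>partial a\<close> is the sum of \<open>\<alpha>\<^bsub>k mod n\<^esub>\<close> over \<open>0 \<le> k < a\<close>, continued to all integers by
  \<open>partial (a + n) = partial a + c\<close>.\<close>

definition partial :: "int \<Rightarrow> nat \<Rightarrow> int" where
  "partial a = (\<lambda>j. if j < n then (a - int j + int n - 1) div int n else 0)"

text \<open>For \<open>a \<le> b\<close> this is the sum of the cyclically indexed simple roots from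
  \<open>a\<close> up to \<open>b - 1\<close>; exchanging the endpoints negates it. It plays the
  part of e_b - e_a in the coordinate model of type A, with e_(a+n) = e_a + c.\<close>

definition iroot :: "int \<Rightarrow> int \<Rightarrow> nat \<Rightarrow> int" where
  "iroot a b = partial b - partial a"

definition simple_at :: "int \<Rightarrow> nat \<Rightarrow> int" where
  "simple_at a = simple_root (nat (a mod int n))"

definition eqmod :: "int \<Rightarrow> int \<Rightarrow> int" where
  "eqmod a b = (if a mod int n = b mod int n then 1 else 0)"

lemma n_pos: "0 < n"
  using n_ge_3 by simp

lemma iroot_self [simp]: "iroot a a = 0"
  by (simp add: iroot_def)

lemma iroot_add: "iroot a b + iroot b d = iroot a d"
  by (simp add: iroot_def)

lemma iroot_minus: "- iroot a b = iroot b a"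
  by (simp add: iroot_def)

lemma partial_shift: "partial (a + k * int n) = partial a + zscale k (cdelta n)"
proof
  fix j
  have "(a + k * int n - int j + int n - 1) div int n = ((a - int j + int n - 1) + k * int n) div int n"
    by (simp add: algebra_simps)
  also have "\<dots> = (a - int j + int n - 1) div int n + k"
    using n_pos by simp
  finally show "partial (a + k * int n) j = (partial a + zscale k (cdelta n)) j"
    by (simp add: partial_def zscale_def cdelta_apply)
qed

lemma iroot_shift_right: "iroot a (b + k * int n) = iroot a b + zscale k (cdelta n)"
  by (simp add: iroot_def partial_shift)

lemma iroot_shift_left: "iroot (a + k * int n) b = iroot a b - zscale k (cdelta n)"
  by (simp add: iroot_def partial_shift)

text \<open>The coefficient at \<open>j\<close> is the ceiling of (a - j)/n. It jumps by one from
  \<open>a\<close> to \<open>a + 1\<close> exactly when \<open>a\<close> is congruent to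
  \<open>j\<close>.\<close>

lemma partial_succ: "partial (a + 1) = partial a + simple_at a"
proof
  fix j
  show "partial (a + 1) j = (partial a + simple_at a) j"
  proof (cases "j < n")
    case True
    have "(x + 1) div int n = x div int n + (if int n dvd x + 1 then 1 else 0)" for x
    proof -
      define q r where "q = x div int n" and "r = x mod int n"
      have x: "x = q * int n + r" and r: "0 \<le> r" "r < int n"
        using n_pos by (auto simp: q_def r_def)
      show ?thesis
      proof (cases "r = int n - 1")
        case True
        then have "x + 1 = (q + 1) * int n" by (simp add: x algebra_simps)
        then show ?thesis using n_pos by (simp add: q_def)
      next
        case False
        then have r': "0 \<le> r + 1" "r + 1 < int n" using r by auto
        have "x + 1 = (r + 1) + q * int n" by (simp add: x)
        then have "(x + 1) div int n = q" "(x + 1) mod int n = r + 1"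
          unfolding x using r' n_pos
          by (metis add.assoc add.commute div_mult_self1 div_pos_pos_trivial add_0 less_numeral_extra(3) of_nat_0_less_iff, metis add.assoc add.commute mod_mult_self1 mod_pos_pos_trivial)
        then show ?thesis using r by (simp add: q_def[symmetric] dvd_eq_mod_eq_0)
      qed
    qed
    from this[of "a - int j + int n - 1"]
    have "(a - int j + int n) div int n
        = (a - int j + int n - 1) div int n + (if int n dvd a - int j + int n then 1 else 0)"
      by simp
    moreover have "int n dvd a - int j + int n \<longleftrightarrow> j = nat (a mod int n)"
    proof -
      have "int n dvd a - int j + int n \<longleftrightarrow> int n dvd a - int j" by simp
      also have "\<dots> \<longleftrightarrow> a mod int n = int j mod int n" by (simp add: mod_eq_dvd_iff)
      also have "\<dots> \<longleftrightarrow> a mod int n = int j" using True by simp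
      also have "\<dots> \<longleftrightarrow> j = nat (a mod int n)" using n_pos by auto
      finally show ?thesis .
    qed
    ultimately show ?thesis
      using True by (simp add: partial_def simple_at_def simple_root_def algebra_simps)
  next
    case False
    then have "j \<noteq> nat (a mod int n)"
      using n_pos by (metis nat_int nat_less_eq_zless not_less of_nat_0_less_iff pos_mod_bound pos_mod_sign)
    then show ?thesis using False by (simp add: partial_def simple_at_def simple_root_def)
  qed
qed

lemma iroot_succ: "iroot a (a + 1) = simple_at a"
  by (simp add: iroot_def partial_succ)

lemma nat_mod_less: "nat (a mod int n) < n"
  using n_pos by (simp add: nat_less_iff)

lemma simple_at_int: "i < n \<Longrightarrow> simple_at (int i) = simple_root i"
  by (simp add: simple_at_def)

lemma iroot_in_Qaff: "iroot a b \<in> Qaff n"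
  by (simp add: iroot_def partial_def Qaff_def)

lemma height_iroot: "height n (iroot a b) = b - a"
proof (rule int_fun_eq_if_increments_eq[where x = a and f = "\<lambda>b. height n (iroot a b)"
      and g = "\<lambda>b. b - a"])
  show "height n (iroot a a) = a - a" by (simp add: height_def)
  fix y
  have "iroot a (y + 1) = iroot a y + iroot y (y + 1)" by (simp add: iroot_add)
  then show "height n (iroot a (y + 1)) - height n (iroot a y) = y + 1 - a - (y - a)"
    by (simp add: height_add iroot_succ simple_at_def height_simple_root nat_mod_less)
qed

lemma iroot_nonneg: "a \<le> b \<Longrightarrow> 0 \<le> iroot a b"
  using n_pos by (auto simp: iroot_def partial_def le_fun_def intro!: zdiv_mono1)

lemma iroot_nonneg_iff: "0 \<le> iroot a b \<longleftrightarrow> a \<le> b"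
proof
  assume "0 \<le> iroot a b"
  then have "height n 0 \<le> height n (iroot a b)" by (rule height_mono)
  then show "a \<le> b" by (simp add: height_iroot, simp add: height_def)
qed (rule iroot_nonneg)

section \<open>Pairings of interval roots\<close>

lemma eqmod_shift [simp]: "eqmod (a + 1) (b + 1) = eqmod a b"
  by (simp add: eqmod_def mod_eq_dvd_iff)

lemma eqmod_self [simp]: "eqmod a a = 1"
  by (simp add: eqmod_def)

lemma eqmod_commute: "eqmod a b = eqmod b a"
  by (simp add: eqmod_def)

lemma eqmod_succ_self: "eqmod a (a + 1) = 0" "eqmod (a + 1) a = 0"
  using n_ge_3 by (simp_all add: eqmod_def mod_eq_dvd_iff)

lemma form_simple_at:
  "form n (simple_at a) (simple_at x) = 2 * eqmod a x - eqmod a (x + 1) - eqmod (a + 1) x"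
proof -
  define i j where "i = nat (a mod int n)" and "j = nat (x mod int n)"
  have ij: "i < n" "j < n" by (simp_all add: i_def j_def nat_mod_less)
  have i: "int i = a mod int n" and j: "int j = x mod int n"
    using n_pos by (simp_all add: i_def j_def)
  have 1: "eqmod a x = (if i = j then 1 else 0)"
    using i j by (auto simp: eqmod_def)
  have "(x + 1) mod int n = int ((j + 1) mod n)"
    by (simp add: zmod_int j mod_simps add.commute)
  then have 2: "eqmod a (x + 1) = (if i = (j + 1) mod n then 1 else 0)"
    using i by (auto simp: eqmod_def)
  have "(a + 1) mod int n = int ((i + 1) mod n)"
    by (simp add: zmod_int i mod_simps add.commute)
  then have 3: "eqmod (a + 1) x = (if j = (i + 1) mod n then 1 else 0)"
    using j by (auto simp: eqmod_def)
  have 4: "i \<noteq> (i + 1) mod n"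
    using n_ge_3 ij by (cases "i + 1 = n") auto
  \<comment> \<open>On a 2-cycle the two neighbours of a node coincide, and the right-hand side
    would give -2 where \<open>cartan\<close> gives -1; \<open>n_ge_3\<close> excludes this.\<close>
  have 5: "\<not> (i = (j + 1) mod n \<and> j = (i + 1) mod n)"
    using n_ge_3 ij by (cases "i + 1 = n"; cases "j + 1 = n") auto
  show ?thesis
    using form_simple_root[OF ij] 4 5
    by (auto simp: simple_at_def i_def[symmetric] j_def[symmetric] 1 2 3 cartan_def)
qed

text \<open>Both sides are additive in each interval, so it suffices to compare increments at the
  right endpoints, which are pairings of simple roots. Induction in both directions covers
  decreasing intervals. The value is what orthonormal vectors e_a, indexed modulo \<open>n\<close>,
  would give for e_b - e_a and e_y - e_x.\<close>

lemma form_iroot: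
  "form n (iroot a b) (iroot x y) = eqmod b y - eqmod b x - eqmod a y + eqmod a x"
proof -
  have simple: "form n (simple_at a) (iroot x y)
      = eqmod (a + 1) y - eqmod (a + 1) x - eqmod a y + eqmod a x" for a
  proof (rule int_fun_eq_if_increments_eq[where x = x and
        f = "\<lambda>y. form n (simple_at a) (iroot x y)"
        and g = "\<lambda>y. eqmod (a + 1) y - eqmod (a + 1) x - eqmod a y + eqmod a x"])
    fix y
    have "iroot x (y + 1) = iroot x y + simple_at y" by (simp add: iroot_add flip: iroot_succ)
    then show "form n (simple_at a) (iroot x (y + 1)) - form n (simple_at a) (iroot x y) =
      eqmod (a + 1) (y + 1) - eqmod (a + 1) x - eqmod a (y + 1) + eqmod a x -
      (eqmod (a + 1) y - eqmod (a + 1) x - eqmod a y + eqmod a x)"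
      by (simp add: form_linear form_simple_at)
  qed simp
  show ?thesis
  proof (rule int_fun_eq_if_increments_eq[where x = a and
        f = "\<lambda>b. form n (iroot a b) (iroot x y)"
        and g = "\<lambda>b. eqmod b y - eqmod b x - eqmod a y + eqmod a x"])
    fix b
    have "iroot a (b + 1) = iroot a b + simple_at b" by (simp add: iroot_add flip: iroot_succ)
    then show "form n (iroot a (b + 1)) (iroot x y) - form n (iroot a b) (iroot x y) =
      eqmod (b + 1) y - eqmod (b + 1) x - eqmod a y + eqmod a x -
      (eqmod b y - eqmod b x - eqmod a y + eqmod a x)"
      by (simp add: form_linear simple)
  qed simp
qed

text \<open>\<open>c\<close> is the interval from 0 to \<open>n\<close>, whose endpoints are
  congruent, so the deltas cancel in pairs. For this reason \<open>transl\<close> sees a root only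
  modulo \<open>c\<close>, and factors of a chain that sum to \<open>c\<close> are forced to
  meet.\<close>

lemma form_cdelta_left [simp]: "form n (cdelta n) \<nu> = 0"
proof -
  have c: "cdelta n = iroot 0 (int n)"
    using iroot_shift_right[of 0 0 1] by (simp add: zscale_def)
  have s: "form n (cdelta n) (simple_root j) = 0" if "j < n" for j
  proof -
    have "simple_root j = iroot (int j) (int j + 1)" using that by (simp add: iroot_succ simple_at_int)
    then show ?thesis by (simp add: c form_iroot) (simp add: eqmod_def)
  qed
  have "form n (cdelta n) \<nu> = (\<Sum>j<n. \<nu> j * (\<Sum>i<n. cdelta n i * cartan n i j))"
    unfolding form_def by (subst sum.swap) (simp add: sum_distrib_left mult.left_commute mult.assoc)
  also have "\<dots> = (\<Sum>j<n. \<nu> j * form n (cdelta n) (simple_root j))"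
  proof (intro sum.cong refl arg_cong2[where f = "(*)"])
    fix j assume "j \<in> {..<n}"
    have "form n (cdelta n) (simple_root j)
      = (\<Sum>i<n. \<Sum>l<n. if l = j then cdelta n i * cartan n i j else 0)"
      unfolding form_def simple_root_def by (intro sum.cong refl) auto
    then show "(\<Sum>i<n. cdelta n i * cartan n i j) = form n (cdelta n) (simple_root j)"
      using \<open>j \<in> {..<n}\<close> by simp
  qed
  also have "\<dots> = 0" by (intro sum.neutral) (auto simp: s)
  finally show ?thesis .
qed

lemma form_cdelta_right [simp]: "form n \<mu> (cdelta n) = 0"
  by (simp add: form_commute[of n \<mu>])

section \<open>Real roots and reflections\<close>

text \<open>The real roots of both signs. Congruent endpoints are excluded because they give the
  multiples of \<open>c\<close>.\<close>

definition roots :: "(nat \<Rightarrow> int) set" where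
  "roots = {iroot a b | a b. \<not> int n dvd b - a}"

definition pos_roots :: "(nat \<Rightarrow> int) set" where
  "pos_roots = {\<beta> \<in> roots. 0 \<le> \<beta>}"

abbreviation mul :: "((nat \<Rightarrow> int) \<Rightarrow> nat \<Rightarrow> int) \<Rightarrow> ((nat \<Rightarrow> int) \<Rightarrow> nat \<Rightarrow> int) \<Rightarrow>
    (nat \<Rightarrow> int) \<Rightarrow> nat \<Rightarrow> int" (infixl "\<star>" 70) where
  "u \<star> v \<equiv> u \<otimes>\<^bsub>GQ n\<^esub> v"

abbreviation refl :: "(nat \<Rightarrow> int) \<Rightarrow> (nat \<Rightarrow> int) \<Rightarrow> nat \<Rightarrow> int" where
  "refl \<equiv> reflection n"

text \<open>The affine permutation of the integers by which the reflection in \<open>iroot x y\<close> acts on the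
  endpoints of interval roots.\<close>

definition swap_mod :: "int \<Rightarrow> int \<Rightarrow> int \<Rightarrow> int" where
  "swap_mod x y a = a + (y - x) * (eqmod a x - eqmod a y)"

lemma eqmod_eq_1_iff: "eqmod a b = 1 \<longleftrightarrow> (\<exists>k. b = a + k * int n)"
proof -
  have "eqmod a b = 1 \<longleftrightarrow> int n dvd b - a"
    by (auto simp: eqmod_def mod_eq_dvd_iff dvd_diff_commute)
  also have "\<dots> \<longleftrightarrow> (\<exists>k. b = a + k * int n)"
    by (metis add.commute diff_add_cancel dvd_triv_right add_diff_cancel_left' dvdE mult.commute)
  finally show ?thesis .
qed

lemma eqmod_cases: "eqmod a b = 0 \<or> eqmod a b = 1"
  by (simp add: eqmod_def)

lemma iroot_in_roots_iff: "\<not> int n dvd b - a \<longleftrightarrow> eqmod a b = 0"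
  by (auto simp: eqmod_def mod_eq_dvd_iff dvd_diff_commute)

lemma rootsE:
  assumes "\<beta> \<in> roots"
  obtains a b where "\<beta> = iroot a b" "eqmod a b = 0"
  using assms by (auto simp: roots_def iroot_in_roots_iff)

lemma rootsI: "eqmod a b = 0 \<Longrightarrow> iroot a b \<in> roots"
  by (auto simp: roots_def iroot_in_roots_iff)

lemma roots_in_Qaff: "\<beta> \<in> roots \<Longrightarrow> \<beta> \<in> Qaff n"
  by (auto elim!: rootsE intro: iroot_in_Qaff)

lemma form_root_self: "\<beta> \<in> roots \<Longrightarrow> form n \<beta> \<beta> = 2"
  by (auto elim!: rootsE simp: form_iroot eqmod_commute)

lemma root_uminus: "\<beta> \<in> roots \<Longrightarrow> - \<beta> \<in> roots"
  by (auto elim!: rootsE simp: iroot_minus eqmod_commute intro!: rootsI)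

lemma root_cases: "\<beta> \<in> roots \<Longrightarrow> \<beta> \<in> pos_roots \<or> - \<beta> \<in> pos_roots"
  using root_uminus[of \<beta>]
  by (elim rootsE) (auto simp: pos_roots_def iroot_minus iroot_nonneg_iff rootsI)

lemma root_nonzero: "\<beta> \<in> roots \<Longrightarrow> \<beta> \<noteq> 0"
  using form_root_self by fastforce

lemma root_nonpos: "\<beta> \<in> roots \<Longrightarrow> \<not> 0 \<le> \<beta> \<Longrightarrow> \<beta> \<le> 0"
  using root_cases[of \<beta>] by (auto simp: pos_roots_def le_fun_def)

lemma root_nonneg_if_coeff_pos: "\<beta> \<in> roots \<Longrightarrow> 0 < \<beta> j \<Longrightarrow> 0 \<le> \<beta>"
  using root_nonpos[of \<beta>] by (metis le_funD not_less zero_fun_apply)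

lemma pos_root_uminus: "\<beta> \<in> pos_roots \<Longrightarrow> \<not> 0 \<le> - \<beta>"
proof
  assume \<beta>: "\<beta> \<in> pos_roots" and "0 \<le> - \<beta>"
  then have "\<beta> = 0" by (auto simp: pos_roots_def le_fun_def fun_eq_iff intro!: antisym)
  with \<beta> show False using root_nonzero by (auto simp: pos_roots_def)
qed

lemma pos_root_coeff_pos:
  assumes "\<beta> \<in> pos_roots"
  obtains j where "j < n" "0 < \<beta> j"
proof -
  have "\<beta> \<noteq> 0" "0 \<le> \<beta>" "\<beta> \<in> Qaff n"
    using assms root_nonzero roots_in_Qaff by (auto simp: pos_roots_def)
  then obtain j where "\<beta> j \<noteq> 0" "0 \<le> \<beta> j" by (auto simp: fun_eq_iff le_fun_def)
  moreover from this have "j < n" using \<open>\<beta> \<in> Qaff n\<close> by (metis (mono_tags, lifting) Qaff_def mem_Collect_eq not_less)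
  ultimately show ?thesis using that by force
qed

lemma simple_root_eq_iroot: "i < n \<Longrightarrow> simple_root i = iroot (int i) (int i + 1)"
  by (simp add: iroot_succ simple_at_int)

lemma simple_root_in_pos_roots: "i < n \<Longrightarrow> simple_root i \<in> pos_roots"
  by (simp add: simple_root_eq_iroot pos_roots_def rootsI eqmod_succ_self iroot_nonneg)

lemma simple_root_in_roots: "i < n \<Longrightarrow> simple_root i \<in> roots"
  using simple_root_in_pos_roots by (simp add: pos_roots_def)

text \<open>\<open>partial\<close> is periodic up to multiples of \<open>c\<close>, so for
  \<open>a\<close> congruent to \<open>x\<close> a move by \<open>y - x\<close> has the same effect
  as at \<open>x\<close> itself. If \<open>a\<close> is congruent to both \<open>x\<close> and
  \<open>y\<close>, the two contributions cancel.\<close>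

lemma partial_swap_mod:
  "partial (swap_mod x y a) = partial a + zscale (eqmod a x - eqmod a y) (iroot x y)"
proof -
  have shift: "partial (a + (y - x)) = partial a + iroot x y" if "eqmod a x = 1" for x y
  proof -
    obtain k where "x = a + k * int n" using \<open>eqmod a x = 1\<close> by (auto simp: eqmod_eq_1_iff)
    then have a: "a + (y - x) = y + (- k) * int n" "x = a + k * int n" by simp_all
    show ?thesis unfolding a(1) partial_shift
      unfolding iroot_def a(2) partial_shift by (simp add: zscale_def fun_eq_iff)
  qed
  consider "eqmod a x = 1" "eqmod a y = 1" | "eqmod a x = 0" "eqmod a y = 0"
    | "eqmod a x = 1" "eqmod a y = 0" | "eqmod a x = 0" "eqmod a y = 1"
    using eqmod_cases by blast
  then show ?thesis
  proof cases
    case 3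
    then show ?thesis using shift[of x y] by (simp add: swap_mod_def zscale_def)
  next
    case 4
    then show ?thesis using shift[of y x]
      by (simp add: swap_mod_def zscale_def iroot_def fun_eq_iff)
  qed (simp_all add: swap_mod_def zscale_def fun_eq_iff)
qed

lemma refl_apply: "\<mu> \<in> Qaff n \<Longrightarrow> refl \<beta> \<mu> = \<mu> - zscale (form n \<mu> \<beta>) \<beta>"
  by (simp add: reflection_def)

lemma refl_iroot: "refl (iroot x y) (iroot a b) = iroot (swap_mod x y a) (swap_mod x y b)"
  by (simp add: refl_apply iroot_in_Qaff form_iroot iroot_def[of "swap_mod x y a"] partial_swap_mod)
    (simp add: iroot_def[of a] zscale_def fun_eq_iff algebra_simps)

text \<open>On residues \<open>swap_mod x y\<close> is the transposition of the classes of
  \<open>x\<close> and \<open>y\<close>, hence injective.\<close>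

lemma eqmod_swap_mod:
  assumes "eqmod x y = 0"
  shows "eqmod (swap_mod x y a) (swap_mod x y b) = eqmod a b"
proof -
  have mod: "swap_mod x y a mod int n = (if a mod int n = x mod int n then y mod int n
     else if a mod int n = y mod int n then x mod int n else a mod int n)" for a
  proof -
    have *: "(a + (y - x)) mod int n = y mod int n" if "a mod int n = x mod int n" for x y
      by (metis that add_diff_eq add_diff_cancel_left' mod_add_left_eq mod_diff_left_eq)
    show ?thesis
      using *[of x y] *[of y x] assms by (auto simp: swap_mod_def eqmod_def algebra_simps split: if_splits)
  qed
  show ?thesis using assms by (auto simp: eqmod_def mod split: if_splits)
qed

lemma refl_root:
  assumes "\<alpha> \<in> roots" "\<beta> \<in> roots"
  shows "refl \<alpha> \<beta> \<in> roots"
  using assms by (auto elim!: rootsE simp: refl_iroot eqmod_swap_mod intro!: rootsI)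

lemma refl_self:
  assumes "\<beta> \<in> roots"
  shows "refl \<beta> \<beta> = - \<beta>"
  using assms by (simp add: refl_apply roots_in_Qaff form_root_self zscale_def fun_eq_iff)

text \<open>Linearity is stated for differences and integer multiples because these are the
  operations in the formula of a reflection. With preservation of the form they yield the
  conjugation rule for reflections at once.\<close>

definition root_isometry :: "((nat \<Rightarrow> int) \<Rightarrow> nat \<Rightarrow> int) \<Rightarrow> bool" where
  "root_isometry w \<longleftrightarrow> w \<in> carrier (GQ n)
    \<and> (\<forall>\<mu>\<in>Qaff n. \<forall>\<nu>\<in>Qaff n. w (\<mu> - \<nu>) = w \<mu> - w \<nu>)
    \<and> (\<forall>\<mu>\<in>Qaff n. \<forall>k. w (zscale k \<mu>) = zscale k (w \<mu>))
    \<and> (\<forall>\<mu>\<in>Qaff n. \<forall>\<nu>\<in>Qaff n. form n (w \<mu>) (w \<nu>) = form n \<mu> \<nu>)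
    \<and> (\<forall>\<beta>\<in>roots. w \<beta> \<in> roots)"

lemma carrier_ext:
  assumes "u \<in> carrier (GQ n)" "v \<in> carrier (GQ n)" "\<And>\<mu>. \<mu> \<in> Qaff n \<Longrightarrow> u \<mu> = v \<mu>"
  shows "u = v"
  using assms by (auto simp: BijGroup_def Bij_def intro: extensionalityI)

lemma carrier_in_Qaff: "u \<in> carrier (GQ n) \<Longrightarrow> \<mu> \<in> Qaff n \<Longrightarrow> u \<mu> \<in> Qaff n"
  by (auto simp: BijGroup_def Bij_def bij_betw_def)

lemma carrier_inj:
  "u \<in> carrier (GQ n) \<Longrightarrow> \<mu> \<in> Qaff n \<Longrightarrow> \<nu> \<in> Qaff n \<Longrightarrow> u \<mu> = u \<nu> \<Longrightarrow> \<mu> = \<nu>"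
  by (auto simp: BijGroup_def Bij_def bij_betw_def inj_on_def)

lemma mul_apply:
  "u \<in> carrier (GQ n) \<Longrightarrow> v \<in> carrier (GQ n) \<Longrightarrow> \<mu> \<in> Qaff n \<Longrightarrow> (u \<star> v) \<mu> = u (v \<mu>)"
  by (simp add: BijGroup_def compose_def)

lemma one_apply: "\<mu> \<in> Qaff n \<Longrightarrow> \<one>\<^bsub>GQ n\<^esub> \<mu> = \<mu>"
  by (simp add: BijGroup_def)

lemma group_GQ: "group (GQ n)"
  by (rule group_BijGroup)

lemma monoid_GQ: "Group.monoid (GQ n)"
  using group_GQ by (rule group.is_monoid)

lemmas one_closed = monoid.one_closed[OF monoid_GQ]
lemmas mul_closed = monoid.m_closed[OF monoid_GQ]
lemmas mul_assoc = monoid.m_assoc[OF monoid_GQ]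
lemmas one_mul = monoid.l_one[OF monoid_GQ]
lemmas mul_one = monoid.r_one[OF monoid_GQ]

lemma isometry_carrier: "root_isometry w \<Longrightarrow> w \<in> carrier (GQ n)"
  by (simp add: root_isometry_def)

lemma isometry_root: "root_isometry w \<Longrightarrow> \<beta> \<in> roots \<Longrightarrow> w \<beta> \<in> roots"
  by (simp add: root_isometry_def)

lemma isometry_uminus: "root_isometry w \<Longrightarrow> \<mu> \<in> Qaff n \<Longrightarrow> w (- \<mu>) = - w \<mu>"
proof -
  assume w: "root_isometry w" and \<mu>: "\<mu> \<in> Qaff n"
  have "zscale (- 1) \<mu> = - \<mu>" for \<mu> by (simp add: zscale_def fun_eq_iff)
  then show ?thesis using w \<mu> by (metis root_isometry_def)
qed

lemma refl_refl:
  assumes "\<beta> \<in> roots" "\<mu> \<in> Qaff n"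
  shows "refl \<beta> (refl \<beta> \<mu>) = \<mu>"
  using assms by (simp add: refl_apply Qaff_closed roots_in_Qaff form_linear form_root_self)
    (simp add: zscale_def fun_eq_iff algebra_simps)

lemma refl_isometry:
  assumes "\<beta> \<in> roots"
  shows "root_isometry (refl \<beta>)"
  unfolding root_isometry_def
proof (intro conjI ballI allI)
  have in_Q: "refl \<beta> \<mu> \<in> Qaff n" if "\<mu> \<in> Qaff n" for \<mu>
    using that assms by (simp add: refl_apply Qaff_closed roots_in_Qaff)
  have "bij_betw (refl \<beta>) (Qaff n) (Qaff n)"
    by (rule bij_betwI[where g = "refl \<beta>"]) (use in_Q refl_refl[OF assms] in auto)
  then show "refl \<beta> \<in> carrier (GQ n)"
    by (simp add: BijGroup_def Bij_def reflection_def)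
  fix \<mu> assume \<mu>: "\<mu> \<in> Qaff n"
  show "refl \<beta> (zscale k \<mu>) = zscale k (refl \<beta> \<mu>)" for k
    using \<mu> by (simp add: refl_apply Qaff_closed form_linear)
      (simp add: zscale_def fun_eq_iff algebra_simps)
  fix \<nu> assume \<nu>: "\<nu> \<in> Qaff n"
  show "refl \<beta> (\<mu> - \<nu>) = refl \<beta> \<mu> - refl \<beta> \<nu>"
    using \<mu> \<nu> by (simp add: refl_apply Qaff_closed form_linear)
      (simp add: zscale_def fun_eq_iff algebra_simps)
  show "form n (refl \<beta> \<mu>) (refl \<beta> \<nu>) = form n \<mu> \<nu>"
    using \<mu> \<nu> assms
    by (simp add: refl_apply form_linear form_root_self form_commute[of n \<beta> \<nu>])
next
  fix \<gamma> assume "\<gamma> \<in> roots"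
  then show "refl \<beta> \<gamma> \<in> roots" using assms by (simp add: refl_root)
qed

lemma one_isometry: "root_isometry \<one>\<^bsub>GQ n\<^esub>"
  unfolding root_isometry_def
  using one_closed by (auto simp: one_apply Qaff_closed roots_in_Qaff)

lemma mul_isometry: "root_isometry u \<Longrightarrow> root_isometry v \<Longrightarrow> root_isometry (u \<star> v)"
  unfolding root_isometry_def
  by (auto simp: mul_apply mul_closed Qaff_closed roots_in_Qaff carrier_in_Qaff)

lemma mul_refl:
  assumes "root_isometry w" "\<beta> \<in> roots"
  shows "w \<star> refl \<beta> = refl (w \<beta>) \<star> w"
proof (rule carrier_ext)
  have wc: "w \<in> carrier (GQ n)" using assms by (simp add: isometry_carrier)
  have bc: "refl \<beta> \<in> carrier (GQ n)" "refl (w \<beta>) \<in> carrier (GQ n)"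
    using assms by (simp_all add: isometry_carrier refl_isometry isometry_root)
  show "w \<star> refl \<beta> \<in> carrier (GQ n)" "refl (w \<beta>) \<star> w \<in> carrier (GQ n)"
    using wc bc by (simp_all add: mul_closed)
  fix \<mu> assume \<mu>: "\<mu> \<in> Qaff n"
  show "(w \<star> refl \<beta>) \<mu> = (refl (w \<beta>) \<star> w) \<mu>"
    using wc bc \<mu> assms
    by (auto simp: mul_apply refl_apply carrier_in_Qaff Qaff_closed roots_in_Qaff root_isometry_def)
qed

lemma refl_mul_refl_self: "\<beta> \<in> roots \<Longrightarrow> refl \<beta> \<star> refl \<beta> = \<one>\<^bsub>GQ n\<^esub>"
  by (rule carrier_ext)
    (simp_all add: mul_closed one_closed isometry_carrier refl_isometry mul_apply refl_refl one_apply)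

lemma mul_refl_cancel:
  "root_isometry u \<Longrightarrow> \<beta> \<in> roots \<Longrightarrow> u \<star> refl \<beta> \<star> refl \<beta> = u"
  by (simp add: mul_assoc isometry_carrier refl_isometry refl_mul_refl_self mul_one)

section \<open>Products of reflections, for words and for chains alike\<close>

definition refl_prod :: "(nat \<Rightarrow> int) list \<Rightarrow> (nat \<Rightarrow> int) \<Rightarrow> nat \<Rightarrow> int" where
  "refl_prod \<beta>s = foldr (\<lambda>\<beta> w. refl \<beta> \<star> w) \<beta>s \<one>\<^bsub>GQ n\<^esub>"

lemma refl_prod_simps [simp]:
  "refl_prod [] = \<one>\<^bsub>GQ n\<^esub>"
  "refl_prod (\<beta> # \<beta>s) = refl \<beta> \<star> refl_prod \<beta>s"
  by (simp_all add: refl_prod_def)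

lemma word_prod_eq: "word_prod n ks = refl_prod (map simple_root ks)"
  by (simp add: word_prod_def refl_prod_def foldr_map comp_def simple_refl_def)

lemma refl_prod_isometry: "set \<beta>s \<subseteq> roots \<Longrightarrow> root_isometry (refl_prod \<beta>s)"
  by (induction \<beta>s) (simp_all add: one_isometry mul_isometry refl_isometry)

lemma refl_prod_append:
  "set \<beta>s \<subseteq> roots \<Longrightarrow> set \<gamma>s \<subseteq> roots \<Longrightarrow>
    refl_prod (\<beta>s @ \<gamma>s) = refl_prod \<beta>s \<star> refl_prod \<gamma>s"
  by (induction \<beta>s)
    (simp_all add: one_mul mul_assoc isometry_carrier refl_prod_isometry refl_isometry)

lemma refl_prod_snoc:
  "set \<beta>s \<subseteq> roots \<Longrightarrow> \<beta> \<in> roots \<Longrightarrow> refl_prod (\<beta>s @ [\<beta>]) = refl_prod \<beta>s \<star> refl \<beta>"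
  by (simp add: refl_prod_append mul_one isometry_carrier refl_isometry)

lemma refl_prod_Cons_apply:
  "set (\<beta> # \<beta>s) \<subseteq> roots \<Longrightarrow> \<mu> \<in> Qaff n \<Longrightarrow>
    refl_prod (\<beta> # \<beta>s) \<mu> = refl \<beta> (refl_prod \<beta>s \<mu>)"
  by (simp add: mul_apply isometry_carrier refl_prod_isometry refl_isometry)

text \<open>A reflection changes a vector only by a multiple of its root. A single coefficient
  preserved in this way suffices to show that the image of a root is positive.\<close>

lemma refl_prod_coeff:
  assumes "set \<beta>s \<subseteq> roots" "\<mu> \<in> Qaff n" "\<And>\<beta>. \<beta> \<in> set \<beta>s \<Longrightarrow> \<beta> j = 0"
  shows "refl_prod \<beta>s \<mu> j = \<mu> j"
  using assms
proof (induction \<beta>s)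
  case (Cons \<beta> \<beta>s)
  then have "refl_prod \<beta>s \<mu> \<in> Qaff n"
    by (simp add: carrier_in_Qaff isometry_carrier refl_prod_isometry)
  with Cons show ?case
    by (simp add: refl_prod_Cons_apply[simplified] refl_apply zscale_def)
qed (simp add: one_apply)

lemma refl_prod_fix:
  assumes "set \<beta>s \<subseteq> roots" "\<mu> \<in> Qaff n" "\<And>\<beta>. \<beta> \<in> set \<beta>s \<Longrightarrow> form n \<mu> \<beta> = 0"
  shows "refl_prod \<beta>s \<mu> = \<mu>"
  using assms
proof (induction \<beta>s)
  case (Cons \<beta> \<beta>s)
  then have "refl_prod (\<beta> # \<beta>s) \<mu> = refl \<beta> \<mu>" by (simp add: refl_prod_Cons_apply[simplified])
  also have "\<dots> = \<mu>" using Cons.prems by (simp add: refl_apply zscale_def fun_eq_iff)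
  finally show ?case .
qed (simp add: one_apply)

lemma refl_prod_rev_cancel:
  assumes "set \<beta>s \<subseteq> roots" "\<mu> \<in> Qaff n"
  shows "refl_prod \<beta>s (refl_prod (rev \<beta>s) \<mu>) = \<mu>"
  using assms
proof (induction \<beta>s arbitrary: \<mu>)
  case (Cons \<beta> \<beta>s)
  have *: "refl_prod (rev \<beta>s @ [\<beta>]) \<mu> = refl_prod (rev \<beta>s) (refl \<beta> \<mu>)"
    using Cons.prems by (simp add: refl_prod_snoc mul_apply isometry_carrier refl_prod_isometry refl_isometry)
  have "refl \<beta> \<mu> \<in> Qaff n" "refl_prod (rev \<beta>s) (refl \<beta> \<mu>) \<in> Qaff n"
    using Cons.prems by (simp_all add: carrier_in_Qaff isometry_carrier refl_prod_isometry refl_isometry)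
  then show ?case
    using Cons by (simp add: * refl_prod_Cons_apply[simplified] refl_refl)
qed (simp add: one_apply)

text \<open>Simple reflections are their own inverses, so words without inverse letters exhaust the
  subgroup. A general \<open>J\<close> serves the affine and the finite group at once.\<close>

lemma generate_simple_refl:
  assumes "J \<subseteq> {0..<n}"
  shows "generate (GQ n) (simple_refl n ` J) = {word_prod n ks | ks. set ks \<subseteq> J}"
proof (intro equalityI subsetI)
  have simple: "simple_root ` J \<subseteq> roots" using assms simple_root_in_roots by auto
  have one_letter: "word_prod n [i] = simple_refl n i" if "i \<in> J" for i
    using that simple
    by (simp add: word_prod_eq mul_one isometry_carrier refl_isometry simple_refl_def image_subset_iff)
  fix w assume "w \<in> generate (GQ n) (simple_refl n ` J)"
  then show "w \<in> {word_prod n ks | ks. set ks \<subseteq> J}"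
  proof induction
    case one
    then show ?case by (auto intro!: exI[of _ "[]"] simp: word_prod_eq)
  next
    case (incl h)
    then obtain i where "i \<in> J" "h = simple_refl n i" by auto
    then show ?case using one_letter by (auto intro!: exI[of _ "[i]"])
  next
    case (inv h)
    then obtain i where i: "i \<in> J" "h = simple_refl n i" by auto
    then have "inv\<^bsub>GQ n\<^esub> h = h"
      using simple group.inv_equality[OF group_GQ, of h h]
      by (auto simp: simple_refl_def refl_mul_refl_self isometry_carrier refl_isometry)
    then show ?case using i one_letter by (auto intro!: exI[of _ "[i]"])
  next
    case (eng u v)
    then obtain ks js where *: "set ks \<subseteq> J" "u = word_prod n ks" "set js \<subseteq> J" "v = word_prod n js"
      by auto
    moreover from * have "simple_root ` set ks \<subseteq> roots" "simple_root ` set js \<subseteq> roots"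
      using simple by auto
    ultimately have "u \<star> v = word_prod n (ks @ js)"
      by (simp add: word_prod_eq refl_prod_append)
    then show ?case using * by (auto intro!: exI[of _ "ks @ js"])
  qed
next
  fix w assume "w \<in> {word_prod n ks | ks. set ks \<subseteq> J}"
  then obtain ks where "set ks \<subseteq> J" "w = word_prod n ks" by auto
  then show "w \<in> generate (GQ n) (simple_refl n ` J)"
    by (induction "ks" arbitrary: w)
      (auto simp: word_prod_def intro: generate.one generate.eng generate.incl)
qed

lemma Waff_iff: "w \<in> Waff n \<longleftrightarrow> (\<exists>ks. set ks \<subseteq> {0..<n} \<and> w = word_prod n ks)"
  by (auto simp: Waff_def generate_simple_refl)

lemma word_in_roots: "set ks \<subseteq> {0..<n} \<Longrightarrow> simple_root ` set ks \<subseteq> roots"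
  using simple_root_in_roots by fastforce

lemma Waff_isometry: "w \<in> Waff n \<Longrightarrow> root_isometry w"
  by (force simp: Waff_iff word_prod_eq intro!: refl_prod_isometry simple_root_in_roots)

lemma one_in_Waff: "\<one>\<^bsub>GQ n\<^esub> \<in> Waff n"
  by (simp add: Waff_def generate.one)

lemma mul_in_Waff: "u \<in> Waff n \<Longrightarrow> v \<in> Waff n \<Longrightarrow> u \<star> v \<in> Waff n"
  by (simp add: Waff_def generate.eng)

lemma simple_refl_in_Waff: "i < n \<Longrightarrow> refl (simple_root i) \<in> Waff n"
  by (auto simp: Waff_def simple_refl_def intro!: generate.incl)

text \<open>A positive root other than \<open>simple_root i\<close> has a positive coefficient away
  from \<open>i\<close>: the multiple of \<open>simple_root i\<close> by m pairs with itself to 2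
  m^2, and the value 2 forces m = 1. The reflection keeps that coefficient.\<close>

lemma simple_refl_pos_root:
  assumes "\<beta> \<in> pos_roots" "i < n" "\<beta> \<noteq> simple_root i"
  shows "refl (simple_root i) \<beta> \<in> pos_roots"
proof -
  have \<beta>: "\<beta> \<in> roots" "0 \<le> \<beta>" using assms by (simp_all add: pos_roots_def)
  have "\<exists>j. j \<noteq> i \<and> 0 < \<beta> j"
  proof (rule ccontr)
    assume "\<nexists>j. j \<noteq> i \<and> 0 < \<beta> j"
    then have "\<beta> j = 0" if "j \<noteq> i" for j
      using that \<beta>(2) by (metis le_funD le_less zero_fun_apply)
    then have eq: "\<beta> = zscale (\<beta> i) (simple_root i)"
      by (auto simp: fun_eq_iff zscale_def simple_root_def)
    have "form n \<beta> \<beta> = \<beta> i * (\<beta> i * 2)"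
      by (subst (1 2) eq)
        (simp add: form_linear form_root_self simple_root_in_roots \<open>i < n\<close>)
    then have "\<beta> i * \<beta> i = 1" using form_root_self[OF \<beta>(1)] by simp
    moreover have "0 \<le> \<beta> i" using \<beta>(2) by (simp add: le_fun_def)
    ultimately have "\<beta> i = 1" by (simp add: zmult_eq_1_iff)
    then show False using eq \<open>\<beta> \<noteq> simple_root i\<close> by (simp add: zscale_def)
  qed
  then obtain j where j: "j \<noteq> i" "0 < \<beta> j" by auto
  then have "0 < refl (simple_root i) \<beta> j"
    using \<beta> by (simp add: refl_apply roots_in_Qaff zscale_def simple_root_def)
  moreover have "refl (simple_root i) \<beta> \<in> roots"
    using \<beta> assms by (simp add: refl_root simple_root_in_roots)
  ultimately show ?thesis
    using root_nonneg_if_coeff_pos by (auto simp: pos_roots_def)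
qed

section \<open>Strong exchange and length\<close>

text \<open>The image of \<open>\<beta>\<close> is positive under the empty suffix and negative
  under the whole word. A simple reflection makes only its own root negative, so at a letter
  \<open>i\<close> where the sign changes, the suffix product u sends \<open>\<beta>\<close> to
  \<open>simple_root i\<close>. Then u s_\<beta> = s_i u, and this s_i cancels the letter.\<close>

lemma strong_exchange:
  assumes "set ks \<subseteq> {0..<n}" "\<beta> \<in> roots" "0 \<le> \<beta>" "\<not> 0 \<le> word_prod n ks \<beta>"
  shows "\<exists>js. set js \<subseteq> {0..<n} \<and> length js < length ks \<and> word_prod n ks \<star> refl \<beta> = word_prod n js"
  using assms
proof (induction ks)
  case Nil
  then show ?case by (simp add: word_prod_eq one_apply roots_in_Qaff)
next
  case (Cons i ks)
  define u where "u = word_prod n ks"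
  have i: "i < n" and ks: "set ks \<subseteq> {0..<n}" using Cons.prems by auto
  then have u: "root_isometry u" by (metis Waff_iff Waff_isometry u_def)
  have si: "root_isometry (refl (simple_root i))" using i by (simp add: refl_isometry simple_root_in_roots)
  have carrier: "u \<in> carrier (GQ n)" "refl (simple_root i) \<in> carrier (GQ n)" "refl \<beta> \<in> carrier (GQ n)"
    using u si Cons.prems by (simp_all add: isometry_carrier refl_isometry)
  have w: "word_prod n (i # ks) = refl (simple_root i) \<star> u"
    by (simp add: word_prod_eq u_def)
  have u\<beta>: "u \<beta> \<in> roots" using u Cons.prems by (simp add: isometry_root)
  show ?case
  proof (cases "0 \<le> u \<beta>")
    case True
    have "word_prod n (i # ks) \<beta> = refl (simple_root i) (u \<beta>)"
      using Cons.prems carrier by (simp add: w mul_apply roots_in_Qaff)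
    with Cons.prems(4) have "\<not> 0 \<le> refl (simple_root i) (u \<beta>)" by metis
    then have "u \<beta> = simple_root i"
      using simple_refl_pos_root[of "u \<beta>" i] True u\<beta> i by (auto simp: pos_roots_def)
    then have "u \<star> refl \<beta> = refl (simple_root i) \<star> u"
      using mul_refl[OF u Cons.prems(2)] by simp
    then have "word_prod n (i # ks) \<star> refl \<beta> = u"
      using carrier i
      by (simp add: w mul_assoc) (simp add: mul_assoc[symmetric] refl_mul_refl_self
          simple_root_in_roots one_mul)
    then show ?thesis using ks by (auto simp: u_def intro!: exI[of _ ks])
  next
    case False
    then obtain js where "set js \<subseteq> {0..<n}" "length js < length ks" "u \<star> refl \<beta> = word_prod n js"
      using Cons.IH[OF ks Cons.prems(2,3)] unfolding u_def by metis
    moreover have "word_prod n (i # js) = refl (simple_root i) \<star> word_prod n js"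
      by (simp add: word_prod_eq)
    ultimately show ?thesis
      using i carrier by (intro exI[of _ "i # js"]) (simp add: w mul_assoc)
  qed
qed

lemma wlength_le: "set ks \<subseteq> {0..<n} \<Longrightarrow> wlength n (word_prod n ks) \<le> length ks"
  unfolding wlength_def by (rule Least_le) auto

lemma reduced_word:
  assumes "w \<in> Waff n"
  obtains ks where "set ks \<subseteq> {0..<n}" "w = word_prod n ks" "length ks = wlength n w"
proof -
  have "\<exists>k ks. length ks = k \<and> set ks \<subseteq> {0..<n} \<and> w = word_prod n ks"
    using assms by (auto simp: Waff_iff)
  from LeastI_ex[OF this] show ?thesis
    using that by (auto simp: wlength_def)
qed

lemma wlength_mul_le:
  assumes "u \<in> Waff n" "v \<in> Waff n"
  shows "wlength n (u \<star> v) \<le> wlength n u + wlength n v"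
proof -
  obtain ks js where *: "set ks \<subseteq> {0..<n}" "u = word_prod n ks" "length ks = wlength n u"
    "set js \<subseteq> {0..<n}" "v = word_prod n js" "length js = wlength n v"
    using assms reduced_word by metis
  then have "u \<star> v = word_prod n (ks @ js)"
    using word_in_roots by (simp add: word_prod_eq refl_prod_append)
  with wlength_le[of "ks @ js"] * show ?thesis by simp
qed

lemma wlength_one [simp]: "wlength n \<one>\<^bsub>GQ n\<^esub> = 0"
  using wlength_le[of "[]"] by (simp add: word_prod_eq)

lemma wlength_simple_refl: "i < n \<Longrightarrow> wlength n (refl (simple_root i)) \<le> 1"
  using wlength_le[of "[i]"]
  by (simp add: word_prod_eq mul_one isometry_carrier refl_isometry simple_root_in_roots)

lemma simple_refl_conj:
  assumes "\<beta> \<in> roots" "i < n"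
  shows "refl \<beta> = refl (simple_root i) \<star> refl (refl (simple_root i) \<beta>) \<star> refl (simple_root i)"
proof -
  let ?s = "refl (simple_root i)"
  have s: "root_isometry ?s" using assms by (simp add: refl_isometry simple_root_in_roots)
  have "?s \<star> refl (?s \<beta>) = refl (?s (?s \<beta>)) \<star> ?s"
    using assms s by (intro mul_refl) (simp_all add: isometry_root)
  then have "?s \<star> refl (?s \<beta>) = refl \<beta> \<star> ?s"
    using assms by (simp add: refl_refl roots_in_Qaff simple_root_in_roots)
  then show ?thesis
    using assms by (simp add: mul_refl_cancel refl_isometry simple_root_in_roots)
qed

text \<open>Reflecting in the simple root at the right end of the interval lowers the height by at
  least 1, while conjugating by it costs at most two letters. Starting from height 1 and one letter
  this gives 2 h - 1.\<close>

lemma refl_in_Waff_length: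
  assumes "\<beta> \<in> pos_roots"
  shows "refl \<beta> \<in> Waff n \<and> int (wlength n (refl \<beta>)) \<le> 2 * height n \<beta> - 1"
  using assms
proof (induction "nat (height n \<beta>)" arbitrary: \<beta> rule: less_induct)
  case less
  have \<beta>: "\<beta> \<in> roots" "0 \<le> \<beta>" using less.prems by (simp_all add: pos_roots_def)
  then obtain a b where ab: "\<beta> = iroot a b" "eqmod a b = 0" by (auto elim: rootsE)
  define i where "i = nat ((b - 1) mod int n)"
  have i: "i < n" by (simp add: i_def nat_mod_less)
  have s: "simple_root i = iroot (b - 1) b"
    using iroot_succ[of "b - 1"] by (simp add: i_def simple_at_def)
  show ?case
  proof (cases "\<beta> = simple_root i")
    case True
    then show ?thesis
      using i wlength_simple_refl[OF i] by (simp add: simple_refl_in_Waff height_simple_root)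
  next
    case False
    let ?\<gamma> = "refl (simple_root i) \<beta>"
    have \<gamma>: "?\<gamma> \<in> pos_roots" using simple_refl_pos_root less.prems i False by simp
    have "eqmod b (b - 1) = 0" using eqmod_succ_self[of "b - 1"] by simp
    \<comment> \<open>\<open>a\<close> can be congruent to \<open>b - 1\<close> when the interval
      winds around the cycle; the pairing is then 2 instead of 1.\<close>
    then have "1 \<le> form n \<beta> (simple_root i)"
      using eqmod_cases[of a "b - 1"] ab by (auto simp: s form_iroot)
    moreover have "height n ?\<gamma> = height n \<beta> - form n \<beta> (simple_root i)"
      using i \<beta> by (simp add: refl_apply roots_in_Qaff height_diff height_zscale height_simple_root)
    moreover have "0 \<le> height n ?\<gamma>"
      using \<gamma> height_mono[of 0 ?\<gamma> n] by (simp add: pos_roots_def height_def)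
    ultimately have h: "height n ?\<gamma> \<le> height n \<beta> - 1" "nat (height n ?\<gamma>) < nat (height n \<beta>)" by auto
    have IH: "refl ?\<gamma> \<in> Waff n" "int (wlength n (refl ?\<gamma>)) \<le> 2 * height n ?\<gamma> - 1"
      using less.hyps[OF h(2) \<gamma>] by auto
    have si: "refl (simple_root i) \<in> Waff n" using i by (rule simple_refl_in_Waff)
    have conj: "refl \<beta> = refl (simple_root i) \<star> refl ?\<gamma> \<star> refl (simple_root i)"
      using \<beta> i by (intro simple_refl_conj)
    have "wlength n (refl \<beta>) \<le> wlength n (refl ?\<gamma>) + 2"
      unfolding conj
      using wlength_mul_le[OF mul_in_Waff[OF si IH(1)] si] wlength_mul_le[OF si IH(1)]
        wlength_simple_refl[OF i] by linarith
    moreover have "refl \<beta> \<in> Waff n" unfolding conj using si IH by (intro mul_in_Waff)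
    ultimately show ?thesis using IH(2) h(1) by linarith
  qed
qed

lemma refl_in_Waff: "\<beta> \<in> pos_roots \<Longrightarrow> refl \<beta> \<in> Waff n"
  by (simp add: refl_in_Waff_length)

lemma refl_prod_in_Waff: "set \<beta>s \<subseteq> pos_roots \<Longrightarrow> refl_prod \<beta>s \<in> Waff n"
  by (induction \<beta>s) (simp_all add: one_in_Waff mul_in_Waff refl_in_Waff)

lemma wlength_refl_less:
  assumes "w \<in> Waff n" "\<beta> \<in> pos_roots" "\<not> 0 \<le> w \<beta>"
  shows "wlength n (w \<star> refl \<beta>) < wlength n w"
proof -
  obtain ks where ks: "set ks \<subseteq> {0..<n}" "w = word_prod n ks" "length ks = wlength n w"
    using reduced_word assms(1) by blast
  then obtain js where "set js \<subseteq> {0..<n}" "length js < length ks" "w \<star> refl \<beta> = word_prod n js"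
    using strong_exchange[of ks \<beta>] assms by (auto simp: pos_roots_def)
  with wlength_le[of js] ks show ?thesis by simp
qed

text \<open>\<open>w \<star> refl \<beta>\<close> sends \<open>\<beta>\<close> to a negative root,
  so the decreasing case applies to it, and a second multiplication by the reflection gives back
  \<open>w\<close>.\<close>

lemma wlength_refl_greater:
  assumes "w \<in> Waff n" "\<beta> \<in> pos_roots" "0 \<le> w \<beta>"
  shows "wlength n w < wlength n (w \<star> refl \<beta>)"
proof -
  have \<beta>: "\<beta> \<in> roots" using assms by (simp add: pos_roots_def)
  have w: "root_isometry w" using assms by (simp add: Waff_isometry)
  have "(w \<star> refl \<beta>) \<beta> = - w \<beta>"
    using \<beta> w by (simp add: mul_apply isometry_carrier refl_isometry roots_in_Qaff refl_self isometry_uminus fun_eq_iff)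
  then have "\<not> 0 \<le> (w \<star> refl \<beta>) \<beta>"
    using pos_root_uminus[of "w \<beta>"] assms(3) isometry_root[OF w \<beta>] by (simp add: pos_roots_def)
  then have "wlength n (w \<star> refl \<beta> \<star> refl \<beta>) < wlength n (w \<star> refl \<beta>)"
    using assms by (intro wlength_refl_less mul_in_Waff refl_in_Waff)
  then show ?thesis using w \<beta> by (simp add: mul_refl_cancel)
qed

section \<open>Finite roots and positive real roots as intervals\<close>

lemma eqmod_in_range:
  assumes "a \<in> {1..int n}" "b \<in> {1..int n}"
  shows "eqmod a b = (if a = b then 1 else 0)"
proof (cases "a = b")
  case False
  have "\<not> int n dvd b - a"
  proof
    assume "int n dvd b - a"
    then have "\<bar>int n\<bar> \<le> \<bar>b - a\<bar>" using False by (intro dvd_imp_le_int) auto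
    then show False using assms by auto
  qed
  then show ?thesis using False by (simp add: iroot_in_roots_iff)
qed simp

text \<open>The letters 1 to n - 1 permute the endpoints 1, ..., n by adjacent transpositions, so
  the orbits of the simple roots stay among these intervals. Conversely, an increasing interval
  grows from a simple root by moving its right end one step at a time, and decreasing intervals are
  negatives of increasing ones.\<close>

lemma fin_roots_eq: "fin_roots n = {iroot a b | a b. a \<in> {1..int n} \<and> b \<in> {1..int n} \<and> a \<noteq> b}"
    (is "_ = ?R")
proof -
  have J: "{1..<n} \<subseteq> {0..<n}" by auto
  have R_roots: "?R \<subseteq> roots"
  proof -
    have "eqmod a b = 0" if "a \<in> {1..int n}" "b \<in> {1..int n}" "a \<noteq> b" for a b
      using that by (simp add: eqmod_in_range)
    then show ?thesis by (auto intro!: rootsI)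
  qed
  have Wfin: "Wfin n = {word_prod n ks | ks. set ks \<subseteq> {1..<n}}"
    unfolding Wfin_def by (rule generate_simple_refl[OF J])
  have word_R: "word_prod n ks \<beta> \<in> ?R" if "set ks \<subseteq> {1..<n}" "\<beta> \<in> ?R" for ks \<beta>
    using that
  proof (induction ks)
    case Nil
    then have "\<beta> \<in> Qaff n" using R_roots roots_in_Qaff by blast
    then show ?case using Nil by (simp add: word_prod_eq one_apply)
  next
    case (Cons i ks)
    then obtain a b where ab: "word_prod n ks \<beta> = iroot a b"
      "a \<in> {1..int n}" "b \<in> {1..int n}" "a \<noteq> b" by auto
    have i: "i \<in> {1..<n}" using Cons.prems by simp
    have "set (map simple_root (i # ks)) \<subseteq> roots"
      using Cons.prems by (auto intro!: simple_root_in_roots)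
    then have "word_prod n (i # ks) \<beta> = refl (simple_root i) (iroot a b)"
      using Cons.prems R_roots roots_in_Qaff ab
      by (subst word_prod_eq, simp only: list.map, subst refl_prod_Cons_apply)
        (auto simp: word_prod_eq)
    also have "\<dots> = iroot (swap_mod (int i) (int i + 1) a) (swap_mod (int i) (int i + 1) b)"
      using i by (simp add: simple_root_eq_iroot refl_iroot)
    finally have w: "word_prod n (i # ks) \<beta> = iroot (swap_mod (int i) (int i + 1) a) (swap_mod (int i) (int i + 1) b)" .
    have "swap_mod (int i) (int i + 1) u = (if u = int i then int i + 1 else if u = int i + 1 then int i else u)"
      if "u \<in> {1..int n}" for u
      using i that by (auto simp: swap_mod_def eqmod_in_range)
    then show ?case using ab i by (force simp: w)
  qed
  have "simple_root i \<in> ?R" if "i \<in> {1..<n}" for i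
  proof -
    have "simple_root i = iroot (int i) (int i + 1)" using that by (simp add: simple_root_eq_iroot)
    then show ?thesis using that by force
  qed
  then have sub: "fin_roots n \<subseteq> ?R"
    using word_R by (auto simp: fin_roots_def Wfin)
  have step: "refl (simple_root i) \<beta> \<in> fin_roots n" if "\<beta> \<in> fin_roots n" "i \<in> {1..<n}" for \<beta> i
  proof -
    obtain ks j where *: "\<beta> = word_prod n ks (simple_root j)" "set ks \<subseteq> {1..<n}" "j \<in> {1..<n}"
      using \<open>\<beta> \<in> fin_roots n\<close> by (auto simp: fin_roots_def Wfin)
    have "set (map simple_root (i # ks)) \<subseteq> roots"
      using * that by (auto intro!: simple_root_in_roots)
    then have "refl (simple_root i) \<beta> = word_prod n (i # ks) (simple_root j)"
      using * by (simp only: word_prod_eq list.map, subst refl_prod_Cons_apply)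
        (auto simp: simple_root_in_Qaff)
    then show ?thesis using * that by (force simp: fin_roots_def Wfin)
  qed
  \<comment> \<open>If the root is w \<alpha>_j, then w s_j sends \<alpha>_j to its
    negative.\<close>
  have neg: "- \<beta> \<in> fin_roots n" if "\<beta> \<in> fin_roots n" for \<beta>
  proof -
    obtain ks j where *: "\<beta> = word_prod n ks (simple_root j)" "set ks \<subseteq> {1..<n}" "j \<in> {1..<n}"
      using \<open>\<beta> \<in> fin_roots n\<close> by (auto simp: fin_roots_def Wfin)
    have r: "set (map simple_root ks) \<subseteq> roots" "simple_root j \<in> roots"
      using * by (auto intro!: simple_root_in_roots)
    have "word_prod n (ks @ [j]) (simple_root j) = word_prod n ks (- simple_root j)"
      using r by (simp add: word_prod_eq refl_prod_snoc mul_apply isometry_carrier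
          refl_prod_isometry refl_isometry roots_in_Qaff refl_self)
    also have "\<dots> = - \<beta>"
      unfolding *(1) word_prod_eq using r
      by (intro isometry_uminus) (auto intro!: refl_prod_isometry roots_in_Qaff)
    finally have "- \<beta> = word_prod n (ks @ [j]) (simple_root j)" by simp
    moreover have "set (ks @ [j]) \<subseteq> {1..<n}" using * by auto
    ultimately show ?thesis using * unfolding fin_roots_def Wfin by blast
  qed
  have pos: "iroot (int a) (int a + 1 + int k) \<in> fin_roots n" if "1 \<le> a" "a + 1 + k \<le> n" for a k
    using that
  proof (induction k)
    case 0
    have "word_prod n [] (simple_root a) = iroot (int a) (int a + 1)"
      using 0 by (simp add: word_prod_eq one_apply iroot_in_Qaff simple_root_eq_iroot)
    moreover have "a \<in> {1..<n}" "set [] \<subseteq> {1..<n}" using 0 by auto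
    ultimately show ?case unfolding fin_roots_def Wfin by (simp, metis (mono_tags, lifting) empty_subsetI empty_set)
  next
    case (Suc k)
    let ?b = "int a + 1 + int k"
    have i: "a + 1 + k \<in> {1..<n}" using Suc.prems by auto
    have "eqmod ?b (int a) = 0" "eqmod (int a) ?b = 0" "eqmod (int a) (?b + 1) = 0"
    proof -
      have "\<not> int n dvd int d" if "0 < d" "d < n" for d
        using that nat_dvd_not_less by auto
      from this[of "1 + k"] this[of "2 + k"] have "\<not> int n dvd 1 + int k" "\<not> int n dvd 2 + int k"
        using Suc.prems by auto
      then show "eqmod (int a) ?b = 0" "eqmod (int a) (?b + 1) = 0"
        by (simp_all add: iroot_in_roots_iff[symmetric] algebra_simps)
      then show "eqmod ?b (int a) = 0" by (simp add: eqmod_commute)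
    qed
    then have "refl (simple_root (a + 1 + k)) (iroot (int a) ?b) = iroot (int a) (?b + 1)"
      using i eqmod_succ_self[of ?b]
      by (simp add: simple_root_eq_iroot refl_iroot swap_mod_def)
        (simp add: algebra_simps)
    moreover have "iroot (int a) ?b \<in> fin_roots n" using Suc by simp
    moreover have "int a + 1 + int (Suc k) = ?b + 1" by simp
    ultimately show ?case using step[OF _ i] by metis
  qed
  have "iroot a b \<in> fin_roots n" if "a \<in> {1..int n}" "b \<in> {1..int n}" "a < b" for a b
    using pos[of "nat a" "nat (b - a - 1)"] that by auto
  then have "iroot a b \<in> fin_roots n" if "a \<in> {1..int n}" "b \<in> {1..int n}" "a \<noteq> b" for a b
    using that neg[of "iroot b a"] by (cases "a < b") (auto simp: iroot_minus)
  with sub show ?thesis by blast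
qed

lemma root_fin_decomp:
  assumes "\<beta> \<in> roots"
  obtains a b m where "a \<in> {1..int n}" "b \<in> {1..int n}" "a \<noteq> b"
    "\<beta> = iroot a b + zscale m (cdelta n)" "iroot a b \<in> fin_roots n"
proof -
  obtain x y where xy: "\<beta> = iroot x y" "eqmod x y = 0" using assms by (rule rootsE)
  \<comment> \<open>Representatives are taken in 1..n and not in 0..n-1, so that an interval between
    them involves only \<alpha>_1, ..., \<alpha>_(n-1) and never \<alpha>_0.\<close>
  define a b k l where "a = (x - 1) mod int n + 1" and "b = (y - 1) mod int n + 1"
    and "k = (x - 1) div int n" and "l = (y - 1) div int n"
  have x: "x = a + k * int n" and y: "y = b + l * int n"
    by (simp_all add: a_def b_def k_def l_def minus_mod_eq_div_mult[symmetric])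
  have range: "a \<in> {1..int n}" "b \<in> {1..int n}"
    using n_pos by (auto simp: a_def b_def intro!: add1_zle_eq[THEN iffD2] pos_mod_bound)
  have "a \<noteq> b" using xy(2) by (auto simp: x y eqmod_def)
  moreover have "\<beta> = iroot a b + zscale (l - k) (cdelta n)"
    by (simp add: xy x y iroot_shift_left iroot_shift_right) (simp add: zscale_def fun_eq_iff algebra_simps)
  moreover have "iroot a b \<in> fin_roots n" using range \<open>a \<noteq> b\<close> by (auto simp: fin_roots_eq)
  ultimately show ?thesis using that[of a b "l - k"] range by blast
qed

text \<open>The endpoints of a finite root differ by less than \<open>n\<close>, so a nonzero shift
  by \<open>m * int n\<close> alone decides which endpoint is larger.\<close>

lemma pos_real_roots_eq: "pos_real_roots n = pos_roots"
proof -
  have fin: "iroot a b \<in> fin_roots n" if "a \<in> {1..int n}" "b \<in> {1..int n}" "a \<noteq> b" for a b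
    using that by (auto simp: fin_roots_eq)
  have root: "iroot a (b + m * int n) \<in> roots" if "a \<in> {1..int n}" "b \<in> {1..int n}" "a \<noteq> b" for a b m
    using that eqmod_in_range[of a b] by (intro rootsI) (simp add: eqmod_def)
  have sign: "0 \<le> iroot a (b + m * int n) \<longleftrightarrow> m > 0 \<or> m = 0 \<and> 0 \<le> iroot a b"
    if "a \<in> {1..int n}" "b \<in> {1..int n}" for a b m
  proof -
    consider "m > 0" | "m = 0" | "m < 0" by linarith
    then show ?thesis
    proof cases
      case 1
      then have "1 * int n \<le> m * int n" by (intro mult_right_mono) auto
      then have "int n \<le> m * int n" by simp
      then have "a \<le> b + m * int n" using that unfolding atLeastAtMost_iff by linarith
      then show ?thesis using 1 by (simp add: iroot_nonneg_iff)
    next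
      case 3
      then have "m * int n \<le> - 1 * int n" by (intro mult_right_mono) auto
      then have "m * int n \<le> - int n" by simp
      then have "\<not> a \<le> b + m * int n" using that unfolding atLeastAtMost_iff by linarith
      then show ?thesis using 3 by (simp add: iroot_nonneg_iff)
    qed simp
  qed
  show ?thesis
  proof (intro equalityI subsetI)
    fix \<beta> assume "\<beta> \<in> pos_real_roots n"
    then obtain a b m where "a \<in> {1..int n}" "b \<in> {1..int n}" "a \<noteq> b"
      "\<beta> = iroot a b + zscale m (cdelta n)" "m > 0 \<or> m = 0 \<and> 0 \<le> iroot a b"
      by (auto simp: pos_real_roots_def fin_pos_roots_def fin_roots_eq)
    then show "\<beta> \<in> pos_roots"
      using root sign by (simp add: pos_roots_def flip: iroot_shift_right)
  next
    fix \<beta> assume "\<beta> \<in> pos_roots"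
    then have \<beta>: "\<beta> \<in> roots" "0 \<le> \<beta>" by (simp_all add: pos_roots_def)
    from \<beta>(1) obtain a b m where ab: "a \<in> {1..int n}" "b \<in> {1..int n}" "a \<noteq> b"
      "\<beta> = iroot a b + zscale m (cdelta n)" "iroot a b \<in> fin_roots n" by (rule root_fin_decomp)
    then have "m > 0 \<or> m = 0 \<and> 0 \<le> iroot a b"
      using \<beta>(2) sign by (simp flip: iroot_shift_right)
    then show "\<beta> \<in> pos_real_roots n"
      using ab fin by (auto simp: pos_real_roots_def fin_pos_roots_def)
  qed
qed

section \<open>Translations\<close>

lemma transl_shift: "transl n (\<beta> + zscale m (cdelta n)) = transl n \<beta>"
  by (simp add: transl_def form_linear)

lemma transl_root: "\<beta> \<in> roots \<Longrightarrow> transl n \<beta> \<in> transl n ` fin_roots n"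
  by (erule root_fin_decomp) (auto simp: transl_shift)

lemma fin_roots_subset_roots: "fin_roots n \<subseteq> roots"
  by (auto simp: fin_roots_eq eqmod_in_range intro!: rootsI)

lemma cdelta_eq_iroot: "cdelta n = iroot a (a + int n)"
  using iroot_shift_right[of a a 1] by (simp add: zscale_def)

lemma cdelta_diff_root:
  assumes "\<beta> \<in> roots"
  shows "cdelta n - \<beta> \<in> roots"
proof -
  obtain a b where ab: "\<beta> = iroot a b" "eqmod a b = 0" using assms by (rule rootsE)
  have "cdelta n - \<beta> = iroot b (a + int n)"
    by (simp add: ab(1) cdelta_eq_iroot[of a]) (simp add: iroot_def)
  then show ?thesis using ab(2) by (auto simp: eqmod_def intro!: rootsI)
qed

text \<open>\<open>c - \<beta>\<close> pairs with every vector as \<open>- \<beta>\<close> does, so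
  modulo \<open>c\<close> the two reflections agree and cancel; what remains is a multiple of
  \<open>c\<close> given by the pairing with \<open>\<beta>\<close>.\<close>

lemma refl_mul_refl_eq_transl:
  assumes "\<beta> \<in> roots"
  shows "refl \<beta> \<star> refl (cdelta n - \<beta>) = transl n (- \<beta>)"
proof (rule extensionalityI[where A = "Qaff n"])
  have c: "refl \<beta> \<in> carrier (GQ n)" "refl (cdelta n - \<beta>) \<in> carrier (GQ n)"
    using assms by (simp_all add: isometry_carrier refl_isometry cdelta_diff_root)
  show "refl \<beta> \<star> refl (cdelta n - \<beta>) \<in> extensional (Qaff n)"
    using mul_closed[OF c] by (auto simp: BijGroup_def Bij_def)
  show "transl n (- \<beta>) \<in> extensional (Qaff n)" by (simp add: transl_def)
  fix \<mu> assume \<mu>: "\<mu> \<in> Qaff n"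
  then have "(refl \<beta> \<star> refl (cdelta n - \<beta>)) \<mu>
      = \<mu> - zscale (- form n \<mu> \<beta>) (cdelta n - \<beta>)
        - zscale (form n \<mu> \<beta> - form n \<mu> \<beta> * 2) \<beta>"
    using c assms
    by (simp add: mul_apply refl_apply Qaff_closed roots_in_Qaff form_linear form_root_self)
      (simp add: fun_eq_iff)
  also have "\<dots> = transl n (- \<beta>) \<mu>"
    using \<mu> by (simp add: transl_def form_linear form_commute[of n \<beta> \<mu>])
      (simp add: zscale_def fun_eq_iff algebra_simps)
  finally show "(refl \<beta> \<star> refl (cdelta n - \<beta>)) \<mu> = transl n (- \<beta>) \<mu>" .
qed

lemma eqmod_between:
  assumes "a < b" "b < a + int n"
  shows "eqmod a b = 0"
proof -
  have "\<not> int n dvd b - a" using assms zdvd_not_zless[of "b - a" "int n"] by auto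
  then show ?thesis by (simp add: iroot_in_roots_iff)
qed

text \<open>A translation depends on its root only modulo \<open>c\<close>, so one endpoint can be
  moved into the period that follows the other. In this form both \<open>iroot a b\<close> and
  \<open>cdelta n - iroot a b\<close> are positive.\<close>

lemma transl_root_normal:
  assumes "\<gamma> \<in> roots"
  obtains a b where "a < b" "b < a + int n" "transl n \<gamma> = transl n (- iroot a b)"
proof -
  obtain x a where xa: "\<gamma> = iroot x a" "eqmod x a = 0" using assms by (rule rootsE)
  define b where "b = a + (x - a) mod int n"
  have "\<not> int n dvd x - a" using xa(2) by (simp add: iroot_in_roots_iff eqmod_commute)
  then have "(x - a) mod int n \<noteq> 0" by (metis mod_0_imp_dvd)
  then have "0 < (x - a) mod int n" "(x - a) mod int n < int n"
    using n_pos pos_mod_sign[of "int n" "x - a"] pos_mod_bound[of "int n" "x - a"] by linarith+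
  then have "a < b" "b < a + int n" by (simp_all add: b_def)
  moreover have "transl n \<gamma> = transl n (- iroot a b)"
  proof -
    have "x = b + ((x - a) div int n) * int n"
      by (simp add: b_def minus_mod_eq_div_mult[symmetric])
    then have "\<gamma> = iroot b a - zscale ((x - a) div int n) (cdelta n)"
      using xa(1) iroot_shift_left by metis
    also have "\<dots> = - iroot a b + zscale (- ((x - a) div int n)) (cdelta n)"
      by (simp add: iroot_minus) (simp add: zscale_def fun_eq_iff)
    finally show ?thesis by (simp only: transl_shift)
  qed
  ultimately show ?thesis by (rule that)
qed

lemma interval_pos_roots:
  assumes "a < b" "b < a + int n"
  shows "iroot a b \<in> pos_roots" "cdelta n - iroot a b \<in> pos_roots"
proof -
  have "iroot a b \<in> roots" using assms by (intro rootsI eqmod_between)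
  moreover have "cdelta n - iroot a b = iroot b (a + int n)"
    by (simp add: cdelta_eq_iroot[of a]) (simp add: iroot_def)
  ultimately show "iroot a b \<in> pos_roots" "cdelta n - iroot a b \<in> pos_roots"
    using assms cdelta_diff_root[of "iroot a b"] by (auto simp: pos_roots_def iroot_nonneg_iff)
qed

lemma transl_in_Waff:
  assumes "\<gamma> \<in> roots"
  shows "transl n \<gamma> \<in> Waff n"
proof -
  obtain a b where ab: "a < b" "b < a + int n" "transl n \<gamma> = transl n (- iroot a b)"
    using assms by (rule transl_root_normal)
  then have "transl n \<gamma> = refl (iroot a b) \<star> refl (cdelta n - iroot a b)"
    using interval_pos_roots by (simp add: refl_mul_refl_eq_transl pos_roots_def)
  then show ?thesis using ab interval_pos_roots by (simp add: mul_in_Waff refl_in_Waff)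
qed

text \<open>A new first letter \<open>i\<close> makes at most one more root negative, the one that
  the remaining word sends to \<open>simple_root i\<close>; injectivity of the action makes it
  unique.\<close>

lemma inversions_le_length:
  assumes "set ks \<subseteq> {0..<n}"
  shows "finite {\<beta> \<in> pos_roots. \<not> 0 \<le> word_prod n ks \<beta>}
    \<and> card {\<beta> \<in> pos_roots. \<not> 0 \<le> word_prod n ks \<beta>} \<le> length ks"
  using assms
proof (induction ks)
  case Nil
  have "{\<beta> \<in> pos_roots. \<not> 0 \<le> word_prod n [] \<beta>} = {}"
    by (auto simp: word_prod_eq one_apply pos_roots_def roots_in_Qaff)
  then show ?case by (simp only: finite.emptyI card.empty simp_thms le0)
next
  case (Cons i ks)
  define u where "u = word_prod n ks"
  define I where "I = {\<beta> \<in> pos_roots. \<not> 0 \<le> u \<beta>}"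
  define J where "J = {\<beta> \<in> pos_roots. u \<beta> = simple_root i}"
  have i: "i < n" and ks: "set ks \<subseteq> {0..<n}" using Cons.prems by auto
  then have u: "root_isometry u" by (metis Waff_iff Waff_isometry u_def)
  have I: "finite I \<and> card I \<le> length ks" unfolding I_def u_def by (rule Cons.IH[OF ks])
  have sub: "{\<beta> \<in> pos_roots. \<not> 0 \<le> word_prod n (i # ks) \<beta>} \<subseteq> I \<union> J"
  proof
    fix \<beta> assume "\<beta> \<in> {\<beta> \<in> pos_roots. \<not> 0 \<le> word_prod n (i # ks) \<beta>}"
    then have \<beta>: "\<beta> \<in> pos_roots" "\<beta> \<in> roots" "\<not> 0 \<le> word_prod n (i # ks) \<beta>"
      by (simp_all add: pos_roots_def)
    have "word_prod n (i # ks) \<beta> = refl (simple_root i) (u \<beta>)"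
      using \<beta>(2) u i
      by (simp add: u_def word_prod_eq mul_apply isometry_carrier refl_isometry
          simple_root_in_roots roots_in_Qaff)
    with \<beta> have "u \<beta> \<notin> pos_roots \<or> u \<beta> = simple_root i"
      using simple_refl_pos_root[OF _ i, of "u \<beta>"] unfolding pos_roots_def by auto
    then show "\<beta> \<in> I \<union> J"
      using \<beta> isometry_root[OF u] by (auto simp: I_def J_def pos_roots_def)
  qed
  have J: "\<exists>\<beta>. J \<subseteq> {\<beta>}"
  proof (cases "J = {}")
    case False
    then obtain \<beta> where \<beta>: "\<beta> \<in> J" by (metis ex_in_conv)
    have "\<gamma> = \<beta>" if "\<gamma> \<in> J" for \<gamma>
      using carrier_inj[OF isometry_carrier[OF u], of \<gamma> \<beta>] \<beta> that
      by (simp add: J_def pos_roots_def roots_in_Qaff)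
    then show ?thesis by (intro exI[of _ \<beta>] subsetI) simp
  qed simp
  then obtain \<beta> where "J \<subseteq> {\<beta>}" by blast
  then have "finite J" "card J \<le> 1"
    using finite_subset[of J "{\<beta>}"] card_mono[of "{\<beta>}" J] by simp_all
  then have "finite (I \<union> J)" "card (I \<union> J) \<le> length (i # ks)"
    using I card_Un_le[of I J] by auto
  then show ?case using sub by (meson card_mono finite_subset order_trans)
qed

text \<open>An interval root determines its endpoints only up to a common shift by a multiple of
  \<open>n\<close>. The pairing 2 forces both positive deltas to be 1, and the height fixes the
  distance.\<close>

lemma iroot_inject:
  assumes "iroot a b = iroot x y" "eqmod a b = 0"
  shows "eqmod a x = 1" "b - a = y - x"
proof -
  have "form n (iroot a b) (iroot x y) = 2"
    using form_root_self[OF rootsI[OF assms(2)]] assms(1) by simp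
  then show "eqmod a x = 1"
    using eqmod_cases[of b y] eqmod_cases[of b x] eqmod_cases[of a y] eqmod_cases[of a x]
    by (auto simp: form_iroot)
  show "b - a = y - x" using assms(1) by (metis height_iroot)
qed

text \<open>A multiple of \<open>c\<close> is absorbed into the right endpoint, so the sign of the
  image is again a comparison of endpoints.\<close>

lemma transl_iroot_apply:
  "transl n (- iroot a b) (iroot x y)
    = iroot x (y - (eqmod a y - eqmod a x - eqmod b y + eqmod b x) * int n)"
  using iroot_shift_right[of x y "- (eqmod a y - eqmod a x - eqmod b y + eqmod b x)"]
  by (simp add: transl_def iroot_in_Qaff form_linear form_iroot)
    (simp add: zscale_def fun_eq_iff algebra_simps)

text \<open>The translation adds to a root its pairing with \<open>iroot a b\<close>, times
  \<open>c\<close>. Positive roots become negative when the pairing is -1 and the height below n, or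
  the pairing is -2 and the height below 2 n. The first kind are intervals that begin at
  \<open>b\<close> or end at \<open>a\<close>, with the other end in neither class, n - 2 of each;
  the second are the intervals from \<open>b\<close> to a + n and to a + 2 n. Altogether 2 (n - 2) +
  2 = 2 (n - 1).\<close>

lemma transl_inversions:
  assumes ab: "a < b" "b < a + int n"
  shows "\<exists>S. S \<subseteq> {\<beta> \<in> pos_roots. \<not> 0 \<le> transl n (- iroot a b) \<beta>} \<and> card S = 2 * (n - 1)"
proof -
  \<comment> \<open>The open range has n - 1 elements and already contains \<open>a + int n\<close>;
    the inserted point is the second right endpoint with pairing -2.\<close>
  define Y where "Y = insert (a + 2 * int n) {b<..<b + int n}"
  \<comment> \<open>\<open>b - int n\<close> is removed because \<open>iroot (b - int n) a\<close>
    equals \<open>iroot b (a + int n)\<close>, which \<open>Y\<close> counts.\<close>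
  define X where "X = {a - int n<..<a} - {b - int n}"
  define S where "S = iroot b ` Y \<union> (\<lambda>x. iroot x a) ` X"
  have eqm: "eqmod a (z + k * int n) = eqmod a z" "eqmod (z + k * int n) a = eqmod z a" for a z k
    by (simp_all add: eqmod_def)
  have ba: "eqmod a b = 0" "eqmod b a = 0" using ab eqmod_between eqmod_commute by metis+
  have Y: "eqmod b y = 0" "b < y" "\<not> 0 \<le> transl n (- iroot a b) (iroot b y)" if "y \<in> Y" for y
  proof -
    show "eqmod b y = 0"
      using that ba eqm(1)[of b a 2] by (auto simp: Y_def eqmod_between)
    show "b < y" using that ab by (auto simp: Y_def)
    show "\<not> 0 \<le> transl n (- iroot a b) (iroot b y)"
    proof (cases "y = a + 2 * int n")
      case True
      then show ?thesis using ab ba eqm(1)[of _ a 2] by (simp add: transl_iroot_apply iroot_nonneg_iff)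
    next
      case False
      then have "y \<in> {b<..<b + int n}" using that by (simp add: Y_def)
      then show ?thesis
        using ba \<open>eqmod b y = 0\<close> eqmod_cases[of a y]
        by (auto simp: transl_iroot_apply iroot_nonneg_iff)
    qed
  qed
  have X: "eqmod x a = 0" "x < a" "eqmod b x = 0" "\<not> 0 \<le> transl n (- iroot a b) (iroot x a)"
    if "x \<in> X" for x
  proof -
    show "eqmod x a = 0" "x < a" using that by (auto simp: X_def intro!: eqmod_between)
    have "x \<noteq> b - int n" "\<bar>b - int n - x\<bar> < int n" using that ab by (auto simp: X_def)
    then have "\<not> int n dvd b - int n - x" using dvd_imp_le_int[of "b - int n - x" "int n"] by auto
    then have "\<not> int n dvd b - x" by (metis dvd_add_triv_right_iff diff_add_cancel diff_right_commute)
    then show "eqmod b x = 0" by (simp add: iroot_in_roots_iff eqmod_commute)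
    then show "\<not> 0 \<le> transl n (- iroot a b) (iroot x a)"
      using that ba \<open>eqmod x a = 0\<close> ab
      by (auto simp: transl_iroot_apply iroot_nonneg_iff eqmod_commute[of a x] X_def)
  qed
  have "S \<subseteq> {\<beta> \<in> pos_roots. \<not> 0 \<le> transl n (- iroot a b) \<beta>}"
    using X Y by (auto simp: S_def pos_roots_def iroot_nonneg_iff less_imp_le intro!: rootsI)
  moreover have "card S = 2 * (n - 1)"
  proof -
    have "inj_on (iroot b) Y"
      using iroot_inject(2)[of b _ b] Y by (fastforce intro!: inj_onI)
    then have cY: "card (iroot b ` Y) = card Y" by (rule card_image)
    have "inj_on (\<lambda>x. iroot x a) X"
      using iroot_inject(2)[of _ a _ a] X by (fastforce intro!: inj_onI)
    then have cX: "card ((\<lambda>x. iroot x a) ` X) = card X" by (rule card_image)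
    have disj: "iroot b ` Y \<inter> (\<lambda>x. iroot x a) ` X = {}"
      using iroot_inject(1) X Y by fastforce
    have "card Y = n" using ab by (simp add: Y_def)
    moreover have "b - int n \<in> {a - int n<..<a}" using ab by auto
    then have "card X = n - 2"
      by (simp add: X_def card_Diff_singleton)
    moreover have "finite X" "finite Y" by (simp_all add: X_def Y_def)
    ultimately show ?thesis
      unfolding S_def using disj cX cY n_ge_3 by (subst card_Un_disjoint) auto
  qed
  ultimately show ?thesis by blast
qed

text \<open>If \<open>iroot a b\<close> has height h, the two reflections need at most 2 h - 1 and 2
  (n - h) - 1 letters. The sum 2 n - 2 is independent of h and equals the number of inversions
  found.\<close>

lemma wlength_transl:
  assumes "\<gamma> \<in> roots"
  shows "wlength n (transl n \<gamma>) = 2 * (n - 1)"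
proof -
  obtain a b where ab: "a < b" "b < a + int n" "transl n \<gamma> = transl n (- iroot a b)"
    using assms by (rule transl_root_normal)
  let ?\<beta> = "iroot a b"
  have pos: "?\<beta> \<in> pos_roots" "cdelta n - ?\<beta> \<in> pos_roots"
    using ab interval_pos_roots by auto
  then have t: "transl n \<gamma> = refl ?\<beta> \<star> refl (cdelta n - ?\<beta>)"
    using ab(3) by (simp add: refl_mul_refl_eq_transl pos_roots_def)
  have "int (wlength n (transl n \<gamma>)) \<le> int (wlength n (refl ?\<beta>)) + int (wlength n (refl (cdelta n - ?\<beta>)))"
    unfolding t using wlength_mul_le[OF refl_in_Waff refl_in_Waff, OF pos] by simp
  then have "int (wlength n (transl n \<gamma>)) \<le> 2 * int n - 2"
    using refl_in_Waff_length[OF pos(1)] refl_in_Waff_length[OF pos(2)]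
    by (simp add: height_diff height_cdelta)
  then have upper: "wlength n (transl n \<gamma>) \<le> 2 * (n - 1)"
    using n_pos by linarith
  obtain ks where ks: "set ks \<subseteq> {0..<n}" "transl n \<gamma> = word_prod n ks"
      "length ks = wlength n (transl n \<gamma>)"
    using reduced_word[OF transl_in_Waff[OF assms]] by blast
  obtain S where S: "S \<subseteq> {\<beta> \<in> pos_roots. \<not> 0 \<le> word_prod n ks \<beta>}" "card S = 2 * (n - 1)"
    using transl_inversions[OF ab(1,2)] ab(3) ks(2) by metis
  have "2 * (n - 1) \<le> wlength n (transl n \<gamma>)"
    using S ks(3) inversions_le_length[OF ks(1)] card_mono[OF _ S(1)] by linarith
  with upper show ?thesis by simp
qed

lemma card_transl_fin_roots: "card (transl n ` fin_roots n) = n * (n - 1)"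
proof -
  define D where "D = {1..int n} \<times> {1..int n} - (\<lambda>a. (a, a)) ` {1..int n}"
  have img: "transl n ` fin_roots n = (\<lambda>(a, b). transl n (iroot a b)) ` D"
    by (auto simp: fin_roots_eq D_def image_iff) (metis (no_types, lifting) atLeastAtMost_iff)+
  have "inj_on (\<lambda>(a, b). transl n (iroot a b)) D"
  proof (rule inj_onI, clarify)
    fix a b x y assume D: "(a, b) \<in> D" "(x, y) \<in> D"
      and eq: "transl n (iroot a b) = transl n (iroot x y)"
    have range: "a \<in> {1..int n}" "b \<in> {1..int n}" "a \<noteq> b"
      "x \<in> {1..int n}" "y \<in> {1..int n}" "x \<noteq> y" using D by (auto simp: D_def)
    \<comment> \<open>Coefficient 0 of \<open>c\<close> is 1, so coefficient 0 of the image reveals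
      the pairing with the argument. Evaluating at the root itself gives pairing 2, which forces
      equal endpoints.\<close>
    have "transl n (iroot a b) (iroot a b) 0 = transl n (iroot x y) (iroot a b) 0"
      using eq by simp
    then have "form n (iroot a b) (iroot a b) = form n (iroot x y) (iroot a b)"
      using n_pos by (simp add: transl_def iroot_in_Qaff zscale_def cdelta_apply)
    then show "a = x \<and> b = y"
      using range by (auto simp: form_iroot eqmod_in_range split: if_splits)
  qed
  then have "card (transl n ` fin_roots n) = card D" by (simp add: img card_image)
  also have "\<dots> = n * n - n"
    unfolding D_def by (subst card_Diff_subset) (auto simp: card_image inj_on_def card_cartesian_product)
  finally show ?thesis by (simp add: diff_mult_distrib2)
qed

section \<open>Bruhat order and curve neighborhoods\<close>

lemma bruhat_le_refl: "u \<in> Waff n \<Longrightarrow> bruhat_le n u u"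
  by (simp add: bruhat_le_def)

lemma bruhat_le_trans: "bruhat_le n u v \<Longrightarrow> bruhat_le n v w \<Longrightarrow> bruhat_le n u w"
  by (auto simp: bruhat_le_def)

lemma bruhat_le_mul_refl:
  assumes "u \<in> Waff n" "\<beta> \<in> pos_roots" "0 \<le> u \<beta>"
  shows "bruhat_le n u (u \<star> refl \<beta>)"
  using assms wlength_refl_greater[OF assms]
  by (auto simp: bruhat_le_def bruhat_step_def pos_real_roots_eq mul_in_Waff refl_in_Waff
      intro!: r_into_rtranclp)

lemma bruhat_le_length:
  assumes "bruhat_le n u v"
  shows "u = v \<or> wlength n u < wlength n v"
proof -
  have "(bruhat_step n)\<^sup>*\<^sup>* u v" using assms by (simp add: bruhat_le_def)
  then show ?thesis by induction (auto simp: bruhat_step_def)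
qed

section \<open>Climbing from a product of reflections to a translation\<close>

lemma pos_root_nonneg: "\<beta> \<in> pos_roots \<Longrightarrow> 0 \<le> \<beta> j"
  by (simp add: pos_roots_def le_fun_def)

lemma pos_roots_subset_roots: "pos_roots \<subseteq> roots"
  by (auto simp: pos_roots_def)

lemma sum_list_pos_roots_nonneg: "set \<beta>s \<subseteq> pos_roots \<Longrightarrow> 0 \<le> sum_list \<beta>s j"
  by (induction \<beta>s) (auto simp: pos_root_nonneg)

lemma sum_list_pos_roots_ge:
  assumes "set \<beta>s \<subseteq> pos_roots" "\<beta> \<in> set \<beta>s"
  shows "\<beta> j \<le> sum_list \<beta>s j"
proof -
  obtain xs ys where "\<beta>s = xs @ \<beta> # ys" using assms(2) by (auto simp: in_set_conv_decomp)
  then show ?thesis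
    using assms(1) sum_list_pos_roots_nonneg[of xs j] sum_list_pos_roots_nonneg[of ys j] by simp
qed

lemma form_sum_list_nonzero:
  assumes "form n (sum_list \<beta>s) \<nu> \<noteq> 0"
  shows "\<exists>\<beta>\<in>set \<beta>s. form n \<beta> \<nu> \<noteq> 0"
  using assms by (induction \<beta>s) (auto simp: form_linear)

text \<open>Only two of the four deltas carry a minus sign. If both are 1, each interval begins
  where the other ends modulo \<open>n\<close>, so together they close up to a multiple of
  \<open>c\<close>.\<close>

lemma form_pair_cases:
  assumes "p \<in> roots" "q \<in> roots"
  shows "- 2 \<le> form n p q"
    and "form n p q = - 2 \<Longrightarrow> \<exists>k. p + q = zscale k (cdelta n)"
proof -
  obtain a b where p: "p = iroot a b" using assms(1) by (rule rootsE)
  obtain x y where q: "q = iroot x y" using assms(2) by (rule rootsE)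
  have f: "form n p q = eqmod b y - eqmod b x - eqmod a y + eqmod a x"
    by (simp add: p q form_iroot)
  note cs = eqmod_cases[of b y] eqmod_cases[of b x] eqmod_cases[of a y] eqmod_cases[of a x]
  show "- 2 \<le> form n p q" using f cs by linarith
  assume "form n p q = - 2"
  then have "eqmod b x = 1" "eqmod a y = 1" using f cs by auto
  then obtain k l where "x = b + k * int n" "y = a + l * int n" by (auto simp: eqmod_eq_1_iff)
  then have "p + q = zscale (l - k) (cdelta n)"
    by (simp add: p q iroot_shift_left iroot_shift_right)
      (simp add: iroot_def zscale_def fun_eq_iff algebra_simps)
  then show "\<exists>k. p + q = zscale k (cdelta n)" by blast
qed

lemma refl_prod_below_transl:
  assumes "set \<beta>s \<subseteq> pos_roots" "sum_list \<beta>s \<le> cdelta n"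
  shows "\<exists>\<gamma>\<in>fin_roots n. bruhat_le n (refl_prod \<beta>s) (transl n \<gamma>)"
  using assms
\<comment> \<open>Appending a simple root raises height and length by 1 each, so the weight 2 on the
  missing height makes the measure drop by 1. Merging keeps the height and shortens the list by
  1.\<close>
proof (induction "nat (2 * (int n - height n (sum_list \<beta>s))) + length \<beta>s" arbitrary: \<beta>s
    rule: less_induct)
  case less
  have roots: "set \<beta>s \<subseteq> roots" using less.prems pos_roots_subset_roots by blast
  have le_c: "sum_list \<beta>s j \<le> cdelta n j" for j using less.prems(2) by (simp add: le_fun_def)
  show ?case
  proof (cases "sum_list \<beta>s = cdelta n")
    case False
    then obtain j where "sum_list \<beta>s j \<noteq> cdelta n j" by (auto simp: fun_eq_iff)
    then have "sum_list \<beta>s j < cdelta n j" using le_c[of j] by simp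
    moreover have "0 \<le> sum_list \<beta>s j" using less.prems(1) by (rule sum_list_pos_roots_nonneg)
    ultimately have j: "j < n" "sum_list \<beta>s j = 0" by (auto simp: cdelta_apply split: if_splits)
    let ?\<alpha> = "simple_root j"
    have \<alpha>: "?\<alpha> \<in> pos_roots" "?\<alpha> \<in> roots"
      using j by (simp_all add: simple_root_in_pos_roots simple_root_in_roots)
    \<comment> \<open>Nonnegative coefficients with sum 0 all vanish, so the product cannot change
      the coefficient 1 of \<alpha>_j at \<open>j\<close>.\<close>
    have "\<beta> j = 0" if "\<beta> \<in> set \<beta>s" for \<beta>
      using sum_list_pos_roots_ge[OF less.prems(1) that, of j] that less.prems(1) j
        pos_root_nonneg[of \<beta> j] by auto
    then have "refl_prod \<beta>s ?\<alpha> j = 1"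
      using refl_prod_coeff[OF roots simple_root_in_Qaff[OF j(1)]] by (simp add: simple_root_def)
    then have "0 \<le> refl_prod \<beta>s ?\<alpha>"
      using root_nonneg_if_coeff_pos[of "refl_prod \<beta>s ?\<alpha>" j]
        isometry_root[OF refl_prod_isometry[OF roots] \<alpha>(2)] by simp
    then have "bruhat_le n (refl_prod \<beta>s) (refl_prod (\<beta>s @ [?\<alpha>]))"
      using less.prems(1) \<alpha> roots
      by (simp add: refl_prod_snoc bruhat_le_mul_refl refl_prod_in_Waff)
    moreover have "\<exists>\<gamma>\<in>fin_roots n. bruhat_le n (refl_prod (\<beta>s @ [?\<alpha>])) (transl n \<gamma>)"
    proof (rule less.hyps)
      have le: "sum_list \<beta>s + ?\<alpha> \<le> cdelta n"
      proof (rule le_funI)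
        fix k
        show "(sum_list \<beta>s + ?\<alpha>) k \<le> cdelta n k"
          using le_c[of k] j by (cases "k = j") (simp_all add: simple_root_def cdelta_apply)
      qed
      then have "height n (sum_list \<beta>s + ?\<alpha>) \<le> height n (cdelta n)" by (rule height_mono)
      then show "nat (2 * (int n - height n (sum_list (\<beta>s @ [?\<alpha>])))) + length (\<beta>s @ [?\<alpha>])
          < nat (2 * (int n - height n (sum_list \<beta>s))) + length \<beta>s"
        using j by (simp add: height_add height_simple_root height_cdelta)
      show "set (\<beta>s @ [?\<alpha>]) \<subseteq> pos_roots" using less.prems(1) \<alpha> by simp
      show "sum_list (\<beta>s @ [?\<alpha>]) \<le> cdelta n"
        using le by simp
    qed
    ultimately show ?thesis using bruhat_le_trans by blast
  next
    case True
    have "cdelta n 0 \<noteq> 0" using n_pos by (simp add: cdelta_apply)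
    then have "\<beta>s \<noteq> []" using True by auto
    then obtain rest q where rest: "\<beta>s = rest @ [q]" by (metis append_butlast_last_id)
    have q: "q \<in> pos_roots" "q \<in> roots" using rest less.prems(1) roots by auto
    \<comment> \<open>\<open>c\<close> is in the radical and \<open>q\<close> pairs to 2 with
      itself, so the other factors pair to -2 with \<open>q\<close> in total. Taking the last one
      with nonzero pairing makes all of \<open>ys\<close> orthogonal to \<open>q\<close>.\<close>
    have "form n (sum_list rest + q) q = 0" using True rest by simp
    then have "form n (sum_list rest) q \<noteq> 0" using q by (simp add: form_add_left form_root_self)
    then obtain xs p ys where split: "rest = xs @ p # ys" "form n p q \<noteq> 0"
      "\<forall>y\<in>set ys. form n y q = 0"
      using split_list_last_prop[OF form_sum_list_nonzero[of rest q]] by auto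
    have \<beta>s: "\<beta>s = xs @ p # ys @ [q]" using rest split by simp
    have pos: "set xs \<subseteq> pos_roots" "set ys \<subseteq> pos_roots" "p \<in> pos_roots"
      using less.prems(1) by (auto simp: \<beta>s)
    then have rts: "set xs \<subseteq> roots" "set ys \<subseteq> roots" "p \<in> roots" "set (rev ys) \<subseteq> roots"
      using pos_roots_subset_roots by auto
    \<comment> \<open>The coefficients of \<open>c\<close> are at most 1, so each index is occupied
      by at most one factor.\<close>
    have sum1: "sum_list xs j + p j + sum_list ys j + q j \<le> 1" for j
      using le_c[of j] by (simp add: \<beta>s cdelta_apply split: if_splits)
    have nonneg: "0 \<le> sum_list xs j" "0 \<le> sum_list ys j" "0 \<le> p j" "0 \<le> q j" for j
      using pos q by (simp_all add: sum_list_pos_roots_nonneg pos_root_nonneg)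
    have disj_pq: "p j = 0 \<or> q j = 0" for j
      using sum1[of j] nonneg[of j] by linarith
    have xs_zero: "\<beta> j = 0" if "\<beta> \<in> set xs" "0 < p j \<or> 0 < q j" for \<beta> j
    proof -
      have "\<beta> j \<le> sum_list xs j" "0 \<le> \<beta> j"
        using that pos sum_list_pos_roots_ge pos_root_nonneg by blast+
      then show ?thesis using that(2) sum1[of j] nonneg[of j] by linarith
    qed
    have ys_zero: "\<beta> j = 0" if "\<beta> \<in> set ys" "0 < p j \<or> 0 < q j" for \<beta> j
    proof -
      have "\<beta> j \<le> sum_list ys j" "0 \<le> \<beta> j"
        using that pos sum_list_pos_roots_ge pos_root_nonneg by blast+
      then show ?thesis using that(2) sum1[of j] nonneg[of j] by linarith
    qed
    have "form n p q \<le> 0"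
      using disj_pq nonneg by (intro form_disjoint_nonpos) (auto simp: le_fun_def)
    then have "form n p q = - 2 \<or> form n p q = - 1"
      using split(2) form_pair_cases(1)[OF rts(3) q(2)] by linarith
    then show ?thesis
    proof
      assume "form n p q = - 2"
      then obtain k where k: "p + q = zscale k (cdelta n)"
        using form_pair_cases(2) rts q by blast
      obtain i where i: "i < n" "0 < p i" using pos(3) by (rule pos_root_coeff_pos)
      have pq: "p j + q j = k" if "j < n" for j
        using k that by (auto simp: fun_eq_iff zscale_def cdelta_apply dest!: spec[of _ j])
      then have "0 < k" using i nonneg(4)[of i] by force
      \<comment> \<open>All coefficients of p + q below \<open>n\<close> equal k > 0, so no index is
        left for the support of another factor.\<close>
      have "\<beta> \<notin> set xs \<union> set ys" for \<beta>
      proof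
        assume "\<beta> \<in> set xs \<union> set ys"
        moreover from this obtain j where "j < n" "0 < \<beta> j" using pos pos_root_coeff_pos by blast
        ultimately show False
          using xs_zero[of \<beta> j] ys_zero[of \<beta> j] pq[of j] nonneg[of j] \<open>0 < k\<close> by force
      qed
      then have "set xs = {}" "set ys = {}" by (metis Un_iff equals0I)+
      then have "\<beta>s = [p, q]" by (simp add: \<beta>s)
      moreover from this have "q = cdelta n - p" using True by (simp add: algebra_simps)
      ultimately have "refl_prod \<beta>s = transl n (- p)"
        using rts q by (simp add: mul_one isometry_carrier refl_isometry refl_mul_refl_eq_transl)
      moreover have "bruhat_le n (refl_prod \<beta>s) (refl_prod \<beta>s)"
        using less.prems(1) by (intro bruhat_le_refl refl_prod_in_Waff)
      ultimately show ?thesis using transl_root[OF root_uminus[OF rts(3)]] by force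
    next
      assume pq: "form n p q = - 1"
      \<comment> \<open>\<open>X\<close> and \<open>Y\<close> do not change coefficients on the supports of \<open>p\<close> and \<open>q\<close>; this makes both
        \<open>p' = Y\<^sup>-\<^sup>1 p\<close> and the image \<open>X q\<close> of \<open>p'\<close> positive, so that \<open>s\<^bsub>p'\<^esub>\<close> lengthens.\<close>
      define X Y where "X = refl_prod xs" and "Y = refl_prod ys"
      define p' where "p' = refl_prod (rev ys) p"
      have X: "root_isometry X" and Y: "root_isometry Y"
        using rts by (simp_all add: X_def Y_def refl_prod_isometry)
      have p_q: "refl p q = p + q"
        using rts q pq by (simp add: refl_apply roots_in_Qaff form_commute[of n q p] zscale_def fun_eq_iff)
      have q_p: "refl q p = p + q"
        using rts q pq by (simp add: refl_apply roots_in_Qaff zscale_def fun_eq_iff)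
      have pq_root: "p + q \<in> roots" using refl_root[OF rts(3) q(2)] by (simp add: p_q)
      then have pq_pos: "p + q \<in> pos_roots" using pos q by (auto simp: pos_roots_def le_fun_def)
      have carrier: "X \<in> carrier (GQ n)" "Y \<in> carrier (GQ n)" "refl p \<in> carrier (GQ n)"
          "refl q \<in> carrier (GQ n)" "refl (p + q) \<in> carrier (GQ n)"
        using X Y rts q pq_root by (simp_all add: isometry_carrier refl_isometry)
      \<comment> \<open>Orthogonality of \<open>q\<close> to \<open>ys\<close> lets s_q pass to the
        left of \<open>Y\<close>, next to s_p.\<close>
      have "Y q = q"
        unfolding Y_def using rts q split(3)
        by (intro refl_prod_fix) (auto simp: roots_in_Qaff form_commute)
      then have Yq: "Y \<star> refl q = refl q \<star> Y" using mul_refl[OF Y q(2)] by simp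
      have v: "refl_prod \<beta>s = X \<star> (refl p \<star> (refl q \<star> Y))"
        using rts q by (simp add: \<beta>s refl_prod_append mul_one carrier Yq flip: X_def Y_def)
      have Yp': "Y p' = p"
        unfolding Y_def p'_def using rts by (intro refl_prod_rev_cancel) (auto simp: roots_in_Qaff)
      have p': "p' \<in> roots"
        unfolding p'_def by (rule isometry_root[OF refl_prod_isometry[OF rts(4)] rts(3)])
      obtain i where i: "0 < p i" using pos(3) by (rule pos_root_coeff_pos)
      have "p' i = p i"
        unfolding p'_def using rts ys_zero i
        by (intro refl_prod_coeff) (auto simp: roots_in_Qaff)
      then have p'_pos: "p' \<in> pos_roots"
        using p' i root_nonneg_if_coeff_pos[of p' i] by (simp add: pos_roots_def)
      obtain j where j: "0 < q j" using q(1) by (rule pos_root_coeff_pos)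
      have "X q j = q j"
        unfolding X_def using rts q xs_zero j
        by (intro refl_prod_coeff) (auto simp: roots_in_Qaff)
      then have Xq: "0 \<le> X q"
        using j root_nonneg_if_coeff_pos[of "X q" j] isometry_root[OF X q(2)] by simp
      have p_pq: "refl p (p + q) = q"
        using refl_refl[OF rts(3) roots_in_Qaff[OF q(2)]] by (simp add: p_q)
      have "refl_prod \<beta>s p' = X (refl p (refl q (Y p')))"
        using carrier p' by (simp add: v mul_apply mul_closed roots_in_Qaff carrier_in_Qaff)
      also have "\<dots> = X q" by (simp only: Yp' q_p p_pq)
      finally have "refl_prod \<beta>s p' = X q" .
      then have "bruhat_le n (refl_prod \<beta>s) (refl_prod \<beta>s \<star> refl p')"
        using Xq p'_pos less.prems(1) by (simp add: bruhat_le_mul_refl refl_prod_in_Waff)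
      \<comment> \<open>Carried across \<open>Y\<close>, the new reflection becomes s_p, and s_p s_q
        s_p is the reflection in s_p q = p + q.\<close>
      moreover have "refl_prod \<beta>s \<star> refl p' = refl_prod (xs @ (p + q) # ys)"
      proof -
        have p'c: "refl p' \<in> carrier (GQ n)" using p' by (simp add: isometry_carrier refl_isometry)
        have Yp'_mul: "Y \<star> refl p' = refl p \<star> Y" using mul_refl[OF Y p'] by (simp add: Yp')
        have "refl p \<star> refl q = refl (p + q) \<star> refl p"
          using mul_refl[OF refl_isometry[OF rts(3)] q(2)] by (simp add: p_q)
        then have "refl p \<star> refl q \<star> refl p = refl (p + q)"
          using rts pq_root by (simp add: mul_refl_cancel refl_isometry)
        then have "refl p \<star> refl q \<star> refl p \<star> Y = refl (p + q) \<star> Y" by simp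
        then have "refl (p + q) \<star> Y = refl p \<star> (refl q \<star> (refl p \<star> Y))"
          using carrier by (simp add: mul_assoc mul_closed)
        then have "refl_prod \<beta>s \<star> refl p' = X \<star> (refl (p + q) \<star> Y)"
          using carrier p'c by (simp add: v mul_assoc mul_closed Yp'_mul)
        then show ?thesis
          using rts pq_root by (simp add: refl_prod_append X_def Y_def)
      qed
      moreover have "\<exists>\<gamma>\<in>fin_roots n. bruhat_le n (refl_prod (xs @ (p + q) # ys)) (transl n \<gamma>)"
      proof (rule less.hyps)
        have sum_eq: "sum_list (xs @ (p + q) # ys) = sum_list \<beta>s" by (simp add: \<beta>s algebra_simps)
        show "nat (2 * (int n - height n (sum_list (xs @ (p + q) # ys)))) + length (xs @ (p + q) # ys)
            < nat (2 * (int n - height n (sum_list \<beta>s))) + length \<beta>s"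
          unfolding sum_eq by (simp add: \<beta>s)
        show "set (xs @ (p + q) # ys) \<subseteq> pos_roots" using pos pq_pos by simp
        show "sum_list (xs @ (p + q) # ys) \<le> cdelta n" unfolding sum_eq by (rule less.prems(2))
      qed
      ultimately show ?thesis using bruhat_le_trans by metis
    qed
  qed
qed

section \<open>Chains of degree at most \<open>c\<close> from the identity\<close>

lemma mg_chain_refl_prod:
  assumes "mg_chain n u v d" "u = \<one>\<^bsub>GQ n\<^esub>"
  shows "\<exists>\<beta>s. set \<beta>s \<subseteq> pos_roots \<and> v = refl_prod \<beta>s \<and> d = sum_list \<beta>s"
  using assms
proof induction
  case (mg_chain_refl u)
  then show ?case by (intro exI[of _ "[]"]) simp
next
  case (mg_chain_step u v d \<alpha>)
  then obtain \<beta>s where \<beta>s: "set \<beta>s \<subseteq> pos_roots" "v = refl_prod \<beta>s" "d = sum_list \<beta>s" by auto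
  then have "set \<beta>s \<subseteq> roots" using pos_roots_subset_roots by blast
  then show ?case
    using \<beta>s mg_chain_step.hyps(2) pos_roots_subset_roots
    by (intro exI[of _ "\<beta>s @ [\<alpha>]"]) (auto simp: pos_real_roots_eq refl_prod_snoc)
qed

lemma reachable_below_transl:
  assumes "v \<in> reachable n (cdelta n) \<one>\<^bsub>GQ n\<^esub>"
  shows "\<exists>\<gamma>\<in>fin_roots n. bruhat_le n v (transl n \<gamma>)"
proof -
  obtain u e where u: "bruhat_le n u \<one>\<^bsub>GQ n\<^esub>" "mg_chain n u v e" "e \<le> cdelta n"
    using assms by (auto simp: reachable_def)
  \<comment> \<open>An element strictly below the identity would have length less than 0.\<close>
  then have "u = \<one>\<^bsub>GQ n\<^esub>" using bruhat_le_length by fastforce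
  with u show ?thesis using mg_chain_refl_prod refl_prod_below_transl by blast
qed

lemma transl_reachable:
  assumes "\<gamma> \<in> fin_roots n"
  shows "transl n \<gamma> \<in> reachable n (cdelta n) \<one>\<^bsub>GQ n\<^esub>"
proof -
  have \<gamma>: "\<gamma> \<in> roots" using assms fin_roots_subset_roots by blast
  then obtain a b where ab: "a < b" "b < a + int n" "transl n \<gamma> = transl n (- iroot a b)"
    by (rule transl_root_normal)
  let ?\<beta> = "iroot a b"
  have pos: "?\<beta> \<in> pos_roots" "cdelta n - ?\<beta> \<in> pos_roots" using ab interval_pos_roots by auto
  \<comment> \<open>Group element and degree are left unsimplified so that they match the
    introduction rules for chains.\<close>
  have "mg_chain n \<one>\<^bsub>GQ n\<^esub> (\<one>\<^bsub>GQ n\<^esub> \<star> refl ?\<beta> \<star> refl (cdelta n - ?\<beta>)) (0 + ?\<beta> + (cdelta n - ?\<beta>))"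
    using pos by (intro mg_chain.intros) (simp_all add: one_in_Waff pos_real_roots_eq)
  moreover have "\<one>\<^bsub>GQ n\<^esub> \<star> refl ?\<beta> \<star> refl (cdelta n - ?\<beta>) = transl n \<gamma>"
    using pos ab by (simp add: one_mul isometry_carrier refl_isometry pos_roots_def refl_mul_refl_eq_transl)
  ultimately have "mg_chain n \<one>\<^bsub>GQ n\<^esub> (transl n \<gamma>) (cdelta n)" by simp
  then show ?thesis
    using transl_in_Waff[OF \<gamma>] bruhat_le_refl[OF one_in_Waff] by (auto simp: reachable_def)
qed

lemma curve_nbhd_cdelta: "curve_nbhd n (cdelta n) \<one>\<^bsub>GQ n\<^esub> = transl n ` fin_roots n"
proof (intro equalityI subsetI)
  fix v assume v: "v \<in> curve_nbhd n (cdelta n) \<one>\<^bsub>GQ n\<^esub>"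
  then obtain \<gamma> where "\<gamma> \<in> fin_roots n" "bruhat_le n v (transl n \<gamma>)"
    using reachable_below_transl by (auto simp: curve_nbhd_def)
  \<comment> \<open>The translation above \<open>v\<close> is itself reachable, so maximality
    identifies the two.\<close>
  then show "v \<in> transl n ` fin_roots n"
    using v transl_reachable by (auto simp: curve_nbhd_def)
next
  fix t assume "t \<in> transl n ` fin_roots n"
  then obtain \<gamma> where \<gamma>: "\<gamma> \<in> fin_roots n" "t = transl n \<gamma>" by auto
  have "v = t" if v: "v \<in> reachable n (cdelta n) \<one>\<^bsub>GQ n\<^esub>" "bruhat_le n t v" for v
  proof -
    \<comment> \<open>\<open>v\<close> is squeezed between two translations of equal length; a
      strict step on either side would raise the length.\<close>
    obtain \<gamma>' where \<gamma>': "\<gamma>' \<in> fin_roots n" "bruhat_le n v (transl n \<gamma>')"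
      using reachable_below_transl[OF v(1)] by auto
    have "wlength n (transl n \<gamma>') = wlength n t"
      using \<gamma> \<gamma>'(1) wlength_transl[OF subsetD[OF fin_roots_subset_roots]] by simp
    then show ?thesis using bruhat_le_length[OF v(2)] bruhat_le_length[OF \<gamma>'(2)] by auto
  qed
  then show "t \<in> curve_nbhd n (cdelta n) \<one>\<^bsub>GQ n\<^esub>"
    using \<gamma> transl_reachable by (auto simp: curve_nbhd_def)
qed

end

theorem theorem1p6:
  fixes n :: nat
  assumes "n \<ge> 3"
  shows "curve_nbhd n (cdelta n) \<one>\<^bsub>GQ n\<^esub> = transl n ` fin_roots n
    \<and> card (curve_nbhd n (cdelta n) \<one>\<^bsub>GQ n\<^esub>) = n * (n - 1)
    \<and> (\<forall>w\<in>curve_nbhd n (cdelta n) \<one>\<^bsub>GQ n\<^esub>. wlength n w = 2 * (n - 1))"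
proof -
  interpret affine_type_A n using assms by unfold_locales
  show ?thesis
    using curve_nbhd_cdelta card_transl_fin_roots wlength_transl fin_roots_subset_roots by auto
qed

end
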